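(* Let $\Gamma\subset\mathbb{R}^2$ be a compact connected set with $\dim_H(\Gamma)>1$. Then for Lebesgue almost every $x\in\mathbb{R}^2$, \[\dim_H(\Gamma_x)\leq \frac{1}{2}+\sqrt{\dim_H(\Gamma)-\frac{3}{4}}.\]
   Context: $\dim_H$ denotes Hausdorff dimension. For a compact set $\Gamma\subset\mathbb{R}^2$ and $x\in\mathbb{R}^2$, the visible part of $\Gamma$ from $x$ is \[\Gamma_x=\{u\in\Gamma: [x,u]\cap\Gamma=\{u\}\},\] where $[x,u]$ denotes the closed line segment joining $x$ to $u$. *)

theory Defs
  imports "HOL-Analysis.Analysis"
begin

text \<open>
  Weight \<open>(diam U)\<^sup>s\<close> of a covering set, with \<open>0\<^sup>0 = 1\<close> and weight \<open>0\<close> for the empty set.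
  The case \<open>s = 0\<close> is separate because \<open>0 powr 0 = 0\<close> in the library.
\<close>

definition diam_weight :: "real \<Rightarrow> 'a::metric_space set \<Rightarrow> ennreal" where
  "diam_weight s U =
     (if U = {} then 0 else if s = 0 then 1 else ennreal (diameter U powr s))"

text \<open>
  Boundedness is required explicitly because \<^const>\<open>diameter\<close> is unspecified on unbounded sets.
  Finite covers are included, since \<open>U i\<close> may be empty.
\<close>

definition delta_cover :: "real \<Rightarrow> 'a::metric_space set \<Rightarrow> (nat \<Rightarrow> 'a set) \<Rightarrow> bool" where
  "delta_cover \<delta> A U \<longleftrightarrow>
     A \<subseteq> (\<Union>i. U i) \<and> (\<forall>i. bounded (U i) \<and> diameter (U i) \<le> \<delta>)"

definition hausdorff_premeasure :: "real \<Rightarrow> real \<Rightarrow> 'a::metric_space set \<Rightarrow> ennreal" where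
  "hausdorff_premeasure s \<delta> A = (INF U\<in>{U. delta_cover \<delta> A U}. \<Sum>i. diam_weight s (U i))"

definition hausdorff_measure :: "real \<Rightarrow> 'a::metric_space set \<Rightarrow> ennreal" where
  "hausdorff_measure s A = (SUP \<delta>\<in>{0<..}. hausdorff_premeasure s \<delta> A)"

text \<open>
  On a Euclidean space the \<open>s\<close>-dimensional Hausdorff measure vanishes for every \<open>s\<close> greater than
  \<open>DIM('a)\<close>, so the infimum is taken over a nonempty set bounded below by \<open>0\<close>, and the
  dimension is a genuine real number.
\<close>

definition hausdorff_dim :: "'a::euclidean_space set \<Rightarrow> real" where
  "hausdorff_dim A = Inf {s. 0 \<le> s \<and> hausdorff_measure s A = 0}"

definition visible_part :: "'a::euclidean_space set \<Rightarrow> 'a \<Rightarrow> 'a set" where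
  "visible_part \<Gamma> x = {u \<in> \<Gamma>. closed_segment x u \<inter> \<Gamma> = {u}}"

end

theory Submission
  imports Defs
begin

text \<open>
  Write \<open>s\<close> for the dimension of \<open>\<Gamma>\<close>. The proof gives the bound \<open>(s + 1) / 2\<close>, which is at most
  \<open>1 / 2 + sqrt (s - 3 / 4)\<close> because \<open>(s - 1) * (s - 3) \<le> 0\<close>.

  The heart is a statement about two observers \<open>y\<close> and \<open>y'\<close> at distance \<open>d\<close> whose joining segment
  avoids \<open>\<Gamma>\<close>. Describe a point by the slopes of the two lines that join it to \<open>y\<close> and to \<open>y'\<close>. Let
  \<open>u2\<close> be visible from \<open>y\<close> and \<open>u3\<close> from \<open>y'\<close>, and let the two lines of sight cross at a point \<open>p\<close>
  before they reach \<open>u2\<close> and \<open>u3\<close>. The sides of the triangle \<open>y p y'\<close> avoid \<open>\<Gamma>\<close>, and \<open>u2\<close> lies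
  outside, so the connected set \<open>\<Gamma>\<close> has no point \<open>u1\<close> inside (\<open>no_point_behind_wall\<close>). In the
  coordinates given by the slopes this forbids a configuration of three points in the set seen by
  both observers. As in the theorem on permutation matrices of Marcus and Tardos, a subset of an
  \<open>N\<close> by \<open>N\<close> board without that configuration has only \<open>O(N)\<close> elements (\<open>card_pattern_free\<close>). At
  scale \<open>r\<close> there are about \<open>1 / r\<close> slopes for each observer, and prescribing both slopes leaves a
  piece of the plane with \<open>O(1 / d)\<close> grid points. Hence the observers see only \<open>O(1 / (r * d))\<close>
  common points of a grid of mesh \<open>r\<close> (\<open>card_commonly_glimpsed\<close>), however large \<open>\<Gamma>\<close> is.

  Place \<open>2^k\<close> observers at equal distances on a segment, with \<open>r = 2^(-k)\<close>. By the inequality of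
  Cauchy and Schwarz, few coincidences between pairs of observers mean that the typical observer
  sees few points: out of a set \<open>P\<close> of grid points such an observer sees on average at most
  \<open>C * sqrt (card P * 2^k * (k + 1))\<close>, where \<open>k + 1\<close> comes from the harmonic sum over the
  distances (\<open>sum_card_glimpsed\<close>). Moving the segment around turns this into the same bound for
  the average over a ball disjoint from \<open>\<Gamma>\<close> (\<open>nn_integral_card_glimpsed\<close>).

  Now let \<open>\<sigma>\<close> be slightly larger than \<open>s\<close>. There are covers of \<open>\<Gamma>\<close> by balls around grid points,
  arbitrarily fine, with at most \<open>T * 2^(k * \<sigma>)\<close> balls of radius about \<open>2^(-k)\<close> (\<open>dyadic_cover\<close>).
  Only those balls that are seen from \<open>x\<close> are needed to cover the visible part from \<open>x\<close>. On
  average over \<open>x\<close> the balls of level \<open>k\<close> among them contribute at most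
  \<open>C * (k + 1) * 2^(k * ((\<sigma> + 1) / 2 - \<tau>))\<close> to the \<open>\<tau>\<close>-dimensional measure. For \<open>\<tau> > (\<sigma> + 1) / 2\<close>
  this is summable, so finer and finer covers have averages tending to \<open>0\<close>, and by the lemma of
  Fatou the measure vanishes for almost every \<open>x\<close> (\<open>AE_local_null_visible_part\<close>).
\<close>

section \<open>Sets of integer pairs without a three-point configuration\<close>

lemma card_le_fibres:
  assumes "finite S" "f ` S \<subseteq> T" "finite T" "\<And>y. y \<in> T \<Longrightarrow> card {x \<in> S. f x = y} \<le> m"
  shows "card S \<le> m * card T"
proof -
  have "S = (\<Union>y\<in>T. {x \<in> S. f x = y})" using assms(2) by auto
  then have "card S \<le> (\<Sum>y\<in>T. card {x \<in> S. f x = y})"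
    using card_UN_le[OF assms(3), of "\<lambda>y. {x \<in> S. f x = y}"] by simp
  also have "\<dots> \<le> (\<Sum>y\<in>T. m)" by (intro sum_mono assms(4))
  finally show ?thesis by (simp add: mult.commute)
qed

lemma card_int_spread:
  fixes X :: "int set"
  assumes "\<And>x y. x \<in> X \<Longrightarrow> y \<in> X \<Longrightarrow> y - x < int L" "finite X"
  shows "card X \<le> L"
proof (cases "X = {}")
  case False
  have "X \<subseteq> {Min X..<Min X + int L}"
  proof
    fix x assume "x \<in> X"
    then show "x \<in> {Min X..<Min X + int L}"
      using assms(1)[OF Min_in[OF assms(2) False], of x] assms(2) by simp
  qed
  then have "card X \<le> card {Min X..<Min X + int L}" by (intro card_mono) auto
  then show ?thesis by simp
qed simp

text \<open>
  Remove from every column the two topmost and from every row the two rightmost positions. A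
  remaining element has an element above it in its column and one to its right in its row, both at
  distance at least two, so by the assumption no element of \<open>S\<close> lies to its lower left by two in
  both coordinates. Hence a diagonal contains at most two remaining elements.
\<close>

lemma card_pattern_free:
  fixes S :: "(int \<times> int) set" and N :: int
  assumes sub: "S \<subseteq> {-N..N} \<times> {-N..N}" and N: "0 \<le> N"
    and avoid: "\<And>i1 j1 i2 j2 i3 j3. (i1,j1) \<in> S \<Longrightarrow> (i2,j2) \<in> S \<Longrightarrow> (i3,j3) \<in> S \<Longrightarrow>
       i1 + 2 \<le> i2 \<Longrightarrow> i2 + 2 \<le> i3 \<Longrightarrow> j1 + 2 \<le> j3 \<Longrightarrow> j3 + 2 \<le> j2 \<Longrightarrow> False"
  shows "real (card S) \<le> 16 * real_of_int N + 6"
proof -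
  have fin: "finite S" by (rule finite_subset[OF sub]) auto
  \<comment> \<open>A and B contain what is removed from the columns and from the rows.\<close>
  define A where "A = {(i,j) \<in> S. \<forall>j'. (i,j') \<in> S \<longrightarrow> j' < j + 2}"
  define B where "B = {(i,j) \<in> S. \<forall>i'. (i',j) \<in> S \<longrightarrow> i' < i + 2}"
  define G where "G = S - A - B"
  have fins: "finite A" "finite B" "finite G"
    using fin by (auto simp: A_def B_def G_def intro: finite_subset[OF _ fin])
  have cA: "card A \<le> 2 * card {-N..N}"
  proof (rule card_le_fibres[where f = fst])
    show "finite A" by fact
    show "fst ` A \<subseteq> {-N..N}" using sub by (auto simp: A_def)
    fix i
    have "card (snd ` {x \<in> A. fst x = i}) \<le> 2"
      by (rule card_int_spread) (use fins in \<open>auto simp: A_def\<close>)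
    moreover have "inj_on snd {x \<in> A. fst x = i}" by (auto simp: inj_on_def)
    ultimately show "card {x \<in> A. fst x = i} \<le> 2" by (simp add: card_image)
  qed auto
  have cB: "card B \<le> 2 * card {-N..N}"
  proof (rule card_le_fibres[where f = snd])
    show "finite B" by fact
    show "snd ` B \<subseteq> {-N..N}" using sub by (auto simp: B_def)
    fix i
    have "card (fst ` {x \<in> B. snd x = i}) \<le> 2"
      by (rule card_int_spread) (use fins in \<open>auto simp: B_def\<close>)
    moreover have "inj_on fst {x \<in> B. snd x = i}" by (auto simp: inj_on_def)
    ultimately show "card {x \<in> B. snd x = i} \<le> 2" by (simp add: card_image)
  qed auto
  have cG: "card G \<le> 2 * card {-2*N..2*N}"
  proof (rule card_le_fibres[where f = "\<lambda>x. fst x - snd x"])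
    show "finite G" by fact
    show "(\<lambda>x. fst x - snd x) ` G \<subseteq> {-2*N..2*N}" using sub by (fastforce simp: G_def)
    fix d
    have no: False if G1: "(i,j) \<in> G" and G2: "(i',j') \<in> G" and "i + 2 \<le> i'" "j + 2 \<le> j'" for i j i' j'
    proof -
      from G2 obtain j2 where "(i',j2) \<in> S" "j' + 2 \<le> j2" by (force simp: G_def A_def)
      moreover from G2 obtain i3 where "(i3,j') \<in> S" "i' + 2 \<le> i3" by (force simp: G_def B_def)
      ultimately show False using avoid[of i j i' j2 i3 j'] G1 that(3,4) by (auto simp: G_def)
    qed
    have "card (fst ` {x \<in> G. fst x - snd x = d}) \<le> 2"
    proof (rule card_int_spread)
      fix x y assume "x \<in> fst ` {x \<in> G. fst x - snd x = d}" "y \<in> fst ` {x \<in> G. fst x - snd x = d}"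
      then have "(x, x - d) \<in> G" "(y, y - d) \<in> G" by (force simp: diff_eq_eq)+
      then show "y - x < int 2" using no[of x "x - d" y "y - d"] by force
    qed (use fins in auto)
    moreover have "inj_on fst {x \<in> G. fst x - snd x = d}" by (auto simp: inj_on_def)
    ultimately show "card {x \<in> G. fst x - snd x = d} \<le> 2" by (simp add: card_image)
  qed auto
  have "card S \<le> card (A \<union> B \<union> G)" by (rule card_mono) (use fins in \<open>auto simp: G_def\<close>)
  also have "\<dots> \<le> card A + card B + card G"
    by (meson card_Un_le add_le_mono le_trans order_refl)
  finally have "card S \<le> 4 * card {-N..N} + 2 * card {-2*N..2*N}" using cA cB cG by linarith
  then have "real (card S) \<le> 4 * real (card {-N..N}) + 2 * real (card {-2*N..2*N})"
    by linarith
  also have "real (card {-N..N}) = 2 * N + 1" using N by simp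
  also have "real (card {-2*N..2*N}) = 4 * N + 1" using N by simp
  finally show ?thesis by simp
qed

section \<open>Tolerant visibility\<close>

text \<open>
  Visibility up to the tolerance \<open>r\<close>: the line of sight may meet \<open>\<Gamma>\<close> within distance \<open>r\<close> of its
  end point. Unlike exact visibility this is an open condition on the observer \<open>x\<close>, so that all
  counting functions below are measurable.
\<close>

definition nearly_visible :: "'a::euclidean_space set \<Rightarrow> real \<Rightarrow> 'a \<Rightarrow> 'a \<Rightarrow> bool" where
  "nearly_visible \<Gamma> r x u \<longleftrightarrow>
     u \<in> \<Gamma> \<and> (\<forall>q\<in>closed_segment x u. r \<le> dist q u \<longrightarrow> q \<notin> \<Gamma>)"

text \<open>
  The point \<open>c\<close> is going to be a grid point of mesh \<open>r\<close>, which stands for the points of \<open>\<Gamma>\<close> near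
  it. The radius \<open>3 * r\<close> is that of the balls in the covers by grid points constructed below.
\<close>

definition glimpsed :: "'a::euclidean_space set \<Rightarrow> real \<Rightarrow> 'a \<Rightarrow> 'a \<Rightarrow> bool" where
  "glimpsed \<Gamma> r x c \<longleftrightarrow> (\<exists>u. nearly_visible \<Gamma> r x u \<and> dist u c \<le> 3 * r)"

lemma visible_part_nearly_visible:
  assumes "u \<in> visible_part \<Gamma> x" "0 < r"
  shows "nearly_visible \<Gamma> r x u"
proof -
  have "q \<notin> \<Gamma>" if "q \<in> closed_segment x u" "r \<le> dist q u" for q
  proof
    assume "q \<in> \<Gamma>"
    then have "q = u" using assms(1) that(1) unfolding visible_part_def by blast
    then show False using that(2) assms(2) by simp
  qed
  then show ?thesis using assms(1) by (auto simp: nearly_visible_def visible_part_def)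
qed

text \<open>
  For fixed \<open>u\<close> the observers whose line of sight to \<open>u\<close> is blocked form the projection of a
  closed set along the compact parameter interval of the segment, hence a closed set. A union over
  \<open>u\<close> of the complements is open.
\<close>

lemma open_glimpsed:
  assumes "compact \<Gamma>"
  shows "open {x. glimpsed \<Gamma> r x c}"
proof -
  have "open {x. \<forall>q\<in>closed_segment x u. r \<le> dist q u \<longrightarrow> q \<notin> \<Gamma>}" for u
  proof -
    define T where "T = {p. (1 - fst p) *\<^sub>R snd p + fst p *\<^sub>R u \<in> \<Gamma>} \<inter>
        {p. r \<le> dist ((1 - fst p) *\<^sub>R snd p + fst p *\<^sub>R u) u}"
    have "closed {p::real \<times> 'a. (1 - fst p) *\<^sub>R snd p + fst p *\<^sub>R u \<in> \<Gamma>}"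
      using continuous_closed_vimage[OF compact_imp_closed[OF assms],
          of "\<lambda>p::real \<times> 'a. (1 - fst p) *\<^sub>R snd p + fst p *\<^sub>R u"]
      by (auto simp: vimage_def intro!: continuous_intros)
    then have "closed T" unfolding T_def
      by (intro closed_Int closed_Collect_le continuous_intros)
    then have "closed {y. \<exists>x. x \<in> {0..1} \<and> (x, y) \<in> T}"
      using closed_compact_projection[of "{0..1::real}" T] by simp
    moreover have "{x. \<forall>q\<in>closed_segment x u. r \<le> dist q u \<longrightarrow> q \<notin> \<Gamma>}
        = - {y. \<exists>x. x \<in> {0..1} \<and> (x, y) \<in> T}"
      by (auto simp: T_def closed_segment_def)
    ultimately show ?thesis by auto
  qed
  then have "open (\<Union>u\<in>{u\<in>\<Gamma>. dist u c \<le> 3 * r}. {x. \<forall>q\<in>closed_segment x u. r \<le> dist q u \<longrightarrow> q \<notin> \<Gamma>})"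
    by blast
  moreover have "(\<Union>u\<in>{u\<in>\<Gamma>. dist u c \<le> 3 * r}. {x. \<forall>q\<in>closed_segment x u. r \<le> dist q u \<longrightarrow> q \<notin> \<Gamma>})
      = {x. glimpsed \<Gamma> r x c}"
    by (auto simp: glimpsed_def nearly_visible_def)
  ultimately show ?thesis by simp
qed

lemma card_glimpsed_measurable:
  assumes "compact \<Gamma>" "finite P"
  shows "(\<lambda>x. ennreal (real (card {c \<in> P. glimpsed \<Gamma> r x c}))) \<in> borel_measurable borel"
proof -
  have eq: "real (card {c \<in> P. glimpsed \<Gamma> r x c}) = (\<Sum>c\<in>P. indicator {x. glimpsed \<Gamma> r x c} x)" for x
    using assms(2) by (simp add: Int_def indicator_def of_bool_def sum.If_cases)
  have "(\<lambda>x. \<Sum>c\<in>P. indicator {x. glimpsed \<Gamma> r x c} x :: real) \<in> borel_measurable borel"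
    by (intro borel_measurable_sum borel_measurable_indicator borel_open open_glimpsed assms(1))
  from measurable_compose[OF this measurable_ennreal] show ?thesis unfolding eq .
qed

section \<open>A triangle that shields from a connected set\<close>

text \<open>
  Coordinates in the plane: observers move in the direction \<open>v\<close> and look in the direction \<open>n\<close>.
\<close>

locale frame =
  fixes n v :: "'a::euclidean_space"
  assumes nn: "n \<bullet> n = 1" and vv: "v \<bullet> v = 1" and nv: "n \<bullet> v = 0"
    and expand: "\<And>u. u = (u \<bullet> n) *\<^sub>R n + (u \<bullet> v) *\<^sub>R v"
begin

lemma vn: "v \<bullet> n = 0" using nv by (simp add: inner_commute)

lemma norms: "norm n = 1" "norm v = 1" using nn vv by (simp_all add: norm_eq_sqrt_inner)

lemma coord_le: "\<bar>u \<bullet> n\<bar> \<le> norm u" "\<bar>u \<bullet> v\<bar> \<le> norm u"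
  using Cauchy_Schwarz_ineq2[of u n] Cauchy_Schwarz_ineq2[of u v] norms by simp_all

lemma frame_eqI: "u \<bullet> n = w \<bullet> n \<Longrightarrow> u \<bullet> v = w \<bullet> v \<Longrightarrow> u = w"
  using expand[of u] expand[of w] by simp

text \<open>
  A point on the line of sight to \<open>u\<close> that falls short of \<open>u\<close> by at least \<open>r\<close> in the direction \<open>n\<close>
  also has distance at least \<open>r\<close> from \<open>u\<close>.
\<close>

lemma point_on_ray_not_in:
  assumes vis: "nearly_visible \<Gamma> r (z + t *\<^sub>R v) u"
    and au: "au = (u - z) \<bullet> n" "0 < au" and mu: "(u - z) \<bullet> v - t = \<mu> * au"
    and a: "0 < (q - z) \<bullet> n" "(q - z) \<bullet> n \<le> au - r" and r: "0 < r"
    and q: "(q - z) \<bullet> v - t = \<mu> * ((q - z) \<bullet> n)"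
  shows "q \<notin> \<Gamma>"
proof -
  define s where "s = ((q - z) \<bullet> n) / au"
  have s: "0 \<le> s" "s \<le> 1" using a r au by (auto simp: s_def)
  have sa: "s * au = (q - z) \<bullet> n" using au by (simp add: s_def)
  have "q = (1 - s) *\<^sub>R (z + t *\<^sub>R v) + s *\<^sub>R u"
  proof (rule frame_eqI)
    show "q \<bullet> n = ((1 - s) *\<^sub>R (z + t *\<^sub>R v) + s *\<^sub>R u) \<bullet> n"
      using sa au(1) vn by (simp add: inner_simps algebra_simps)
    have "s * ((u - z) \<bullet> v - t) = (q - z) \<bullet> v - t" using mu q sa by (metis mult.left_commute)
    then show "q \<bullet> v = ((1 - s) *\<^sub>R (z + t *\<^sub>R v) + s *\<^sub>R u) \<bullet> v"
      using vv by (simp add: inner_simps algebra_simps)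
  qed
  then have "q \<in> closed_segment (z + t *\<^sub>R v) u" using s by (auto simp: closed_segment_def)
  moreover have "r \<le> dist q u"
    using coord_le(1)[of "u - q"] a au(1) by (simp add: dist_norm norm_minus_commute inner_simps)
  ultimately show ?thesis using vis by (auto simp: nearly_visible_def)
qed

text \<open>
  The lines of sight with slope \<open>\<mu>\<close> from \<open>z + t v\<close> and with slope \<open>\<nu>\<close> from \<open>z + t' v\<close> bound,
  together with the segment between the observers, an open triangle \<open>T\<close>. Its apex has
  \<open>n\<close>-coordinate \<open>(t' - t) / (\<mu> - \<nu>)\<close>, and the assumptions \<open>short2\<close>, \<open>short3\<close> put it at least \<open>r\<close>
  before \<open>u2\<close> and \<open>u3\<close>. So no side of the triangle meets \<open>\<Gamma>\<close>, and \<open>\<Gamma>\<close> would be disconnected if it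
  had the point \<open>u1\<close> inside, since \<open>u2\<close> is outside.
\<close>

lemma no_point_behind_wall:
  assumes conn: "connected \<Gamma>"
    and base: "\<And>\<tau>. t \<le> \<tau> \<Longrightarrow> \<tau> \<le> t' \<Longrightarrow> z + \<tau> *\<^sub>R v \<notin> \<Gamma>"
    and vis2: "nearly_visible \<Gamma> r (z + t *\<^sub>R v) u2" and vis3: "nearly_visible \<Gamma> r (z + t' *\<^sub>R v) u3"
    and a2: "a2 = (u2 - z) \<bullet> n" "0 < a2" and a3: "a3 = (u3 - z) \<bullet> n" "0 < a3"
    and mu: "(u2 - z) \<bullet> v - t = \<mu> * a2" and nu: "(u3 - z) \<bullet> v - t' = \<nu> * a3"
    and r: "0 < r" and munu: "\<nu> < \<mu>"
    and short2: "t' - t \<le> (\<mu> - \<nu>) * (a2 - r)" and short3: "t' - t \<le> (\<mu> - \<nu>) * (a3 - r)"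
    and u1: "u1 \<in> \<Gamma>" "0 < (u1 - z) \<bullet> n"
      "(u1 - z) \<bullet> v - t > \<mu> * ((u1 - z) \<bullet> n)" "(u1 - z) \<bullet> v - t' < \<nu> * ((u1 - z) \<bullet> n)"
  shows False
proof -
  \<comment> \<open>T is the open triangle and T' the closed one.\<close>
  define T where "T = {u. (u - z) \<bullet> n > 0 \<and> (u - z) \<bullet> v - t > \<mu> * ((u - z) \<bullet> n) \<and>
    (u - z) \<bullet> v - t' < \<nu> * ((u - z) \<bullet> n)}"
  define T' where "T' = {u. (u - z) \<bullet> n \<ge> 0 \<and> (u - z) \<bullet> v - t \<ge> \<mu> * ((u - z) \<bullet> n) \<and>
    (u - z) \<bullet> v - t' \<le> \<nu> * ((u - z) \<bullet> n)}"
  have opT: "open T" unfolding T_def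
    by (intro open_Collect_conj open_Collect_less continuous_intros)
  have clT: "closed T'" unfolding T'_def
    by (intro closed_Collect_conj closed_Collect_le continuous_intros)
  have short: "a \<le> b - r" if "a * (\<mu> - \<nu>) \<le> t' - t" "t' - t \<le> (\<mu> - \<nu>) * (b - r)" for a b
    using that munu by (smt (verit, ccfv_SIG) mult.commute mult_less_cancel_right)
  have boundary: "q \<in> T" if qG: "q \<in> \<Gamma>" and qT: "q \<in> T'" for q
  proof (rule ccontr)
    assume "q \<notin> T"
    have le: "(q - z) \<bullet> n * (\<mu> - \<nu>) \<le> t' - t" using qT by (simp add: T'_def algebra_simps)
    note sh = short[OF le short2] short[OF le short3]
    consider "(q - z) \<bullet> n = 0" | "(q - z) \<bullet> n > 0" "(q - z) \<bullet> v - t = \<mu> * ((q - z) \<bullet> n)"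
      | "(q - z) \<bullet> n > 0" "(q - z) \<bullet> v - t' = \<nu> * ((q - z) \<bullet> n)"
      using qT \<open>q \<notin> T\<close> unfolding T_def T'_def by (smt (verit, best) mem_Collect_eq)
    then show False
    proof cases
      case 1
      have "q - z = ((q - z) \<bullet> v) *\<^sub>R v" using expand[of "q - z"] 1 by simp
      then have "q = z + ((q - z) \<bullet> v) *\<^sub>R v" by (metis add.commute diff_add_cancel)
      moreover have "t \<le> (q - z) \<bullet> v" "(q - z) \<bullet> v \<le> t'" using qT 1 by (auto simp: T'_def)
      ultimately show False using base qG by metis
    next
      case 2
      then show False using point_on_ray_not_in[OF vis2 a2 mu 2(1) sh(1) r 2(2)] qG by simp
    next
      case 3
      then show False using point_on_ray_not_in[OF vis3 a3 nu 3(1) sh(2) r 3(2)] qG by simp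
    qed
  qed
  have "u1 \<in> T" using u1 by (simp add: T_def)
  moreover have "u2 \<in> \<Gamma>" using vis2 by (simp add: nearly_visible_def)
  moreover have "u2 \<notin> T" using mu a2 by (simp add: T_def)
  moreover have "\<Gamma> \<subseteq> T \<union> (- T')" using boundary by auto
  moreover have "T \<inter> (- T') = {}" by (auto simp: T_def T'_def)
  ultimately show False
    using connectedD[OF conn opT, of "- T'"] clT u1(1) boundary by blast
qed

end

section \<open>Grid points seen by two observers\<close>

lemma floor_gap:
  assumes "0 < h" "\<lfloor>(a::real) / h\<rfloor> + 2 \<le> \<lfloor>b / h\<rfloor>"
  shows "a + h < b"
proof -
  have "a / h + 1 < b / h" using assms(2) by linarith
  then have "(a / h + 1) * h < b / h * h" using assms(1) by (simp only: mult_less_cancel_right_pos)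
  then show ?thesis using assms(1) by (simp add: algebra_simps)
qed

lemma floor_same: "\<lfloor>a::real\<rfloor> = \<lfloor>b\<rfloor> \<Longrightarrow> \<bar>a - b\<bar> < 1"
  by linarith

text \<open>
  Here \<open>x\<close> is the difference of the two slopes and \<open>a\<close> the \<open>n\<close>-coordinate of a point at the end of
  a line of sight. A difference \<open>d / a\<close> of the slopes would mean that the lines meet exactly at
  the \<open>n\<close>-coordinate \<open>a\<close>; the surplus \<open>h / 2\<close> makes them meet earlier by at least \<open>r\<close>.
\<close>

lemma wall_is_short:
  fixes \<kappa> a d \<rho> r h x :: real
  assumes "0 < \<kappa>" "\<kappa> \<le> a" "0 < d" "d \<le> \<rho>" "0 < r" "2 * r \<le> \<kappa>" "4 * \<rho> / \<kappa>\<^sup>2 * r \<le> h" "0 \<le> h"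
    and x: "d / a + h / 2 \<le> x"
  shows "d \<le> x * (a - r)"
proof -
  have "d * r / a \<le> \<rho> * r / \<kappa>" using assms by (intro frac_le mult_right_mono) auto
  also have "\<dots> = (2 * \<rho> / \<kappa>\<^sup>2 * r) * (\<kappa> / 2)" using assms by (simp add: power2_eq_square)
  also have "\<dots> \<le> (h / 2) * (a - r)" using assms by (intro mult_mono) auto
  finally have "d \<le> (d / a + h / 2) * (a - r)" using assms by (simp add: field_simps)
  also have "\<dots> \<le> x * (a - r)" using assms by (intro mult_right_mono) auto
  finally show ?thesis .
qed

context frame
begin

definition slope :: "'a \<Rightarrow> real \<Rightarrow> 'a \<Rightarrow> real" where
  "slope z t u = ((u - z) \<bullet> v - t) / ((u - z) \<bullet> n)"

lemma slope_lipschitz: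
  assumes k: "0 < \<kappa>" and u: "\<kappa> \<le> (u - z) \<bullet> n" and w: "\<kappa> \<le> (w - z) \<bullet> n"
    and B: "\<bar>(w - z) \<bullet> v - t\<bar> \<le> B"
  shows "\<bar>slope z t u - slope z t w\<bar> \<le> (1 / \<kappa> + B / \<kappa>\<^sup>2) * dist u w"
proof -
  define a a' b b' where "a = (u - z) \<bullet> n" and "a' = (w - z) \<bullet> n" and "b = (u - z) \<bullet> v - t" and "b' = (w - z) \<bullet> v - t"
  have pos: "0 < a" "0 < a'" using u w k by (auto simp: a_def a'_def)
  have da: "\<bar>a' - a\<bar> \<le> dist u w" "\<bar>b - b'\<bar> \<le> dist u w"
    using coord_le[of "u - w"] by (auto simp: a_def a'_def b_def b'_def dist_norm inner_simps)
  have "slope z t u - slope z t w = (b - b') / a + b' * (a' - a) / (a * a')"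
    unfolding slope_def a_def[symmetric] a'_def[symmetric] b_def[symmetric] b'_def[symmetric]
    using pos by (simp add: field_simps)
  also have "\<bar>\<dots>\<bar> \<le> \<bar>b - b'\<bar> / a + \<bar>b'\<bar> * \<bar>a' - a\<bar> / (a * a')"
    using pos by (intro order_trans[OF abs_triangle_ineq]) (simp add: abs_mult)
  also have "\<dots> \<le> dist u w / \<kappa> + B * dist u w / (\<kappa> * \<kappa>)"
    using pos da B k u w
    by (intro add_mono frac_le mult_mono) (auto simp: a_def a'_def b'_def)
  also have "\<dots> = (1 / \<kappa> + B / \<kappa>\<^sup>2) * dist u w" by (simp add: power2_eq_square algebra_simps)
  finally show ?thesis .
qed

lemma slope_diff:
  "(u - z) \<bullet> n \<noteq> 0 \<Longrightarrow> slope z t u - slope z t' u = (t' - t) / ((u - z) \<bullet> n)"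
  by (simp add: slope_def field_simps)

lemma slope_mult: "(u - z) \<bullet> n \<noteq> 0 \<Longrightarrow> (u - z) \<bullet> v - t = slope z t u * ((u - z) \<bullet> n)"
  by (simp add: slope_def)

text \<open>
  Only the form \<open>K / (r * (t' - t))\<close> of the bound matters, with \<open>K\<close> depending on \<open>\<kappa>\<close>, \<open>D\<close> and \<open>\<rho>\<close>
  alone. The two slopes of a grid point are rounded to multiples of \<open>h = A * r\<close>. By
  \<open>no_point_behind_wall\<close> the resulting pairs of integers avoid the configuration of
  \<open>card_pattern_free\<close>, so there are \<open>O(1 / r)\<close> of them. The slopes differ by \<open>(t' - t) / a\<close> at a
  point with \<open>n\<close>-coordinate \<open>a\<close>, so a pair of rounded slopes determines \<open>a\<close> up to
  \<open>O(r / (t' - t))\<close> and then, for given \<open>a\<close>, the other coordinate up to \<open>O(r)\<close>.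
\<close>

lemma card_commonly_glimpsed:
  fixes \<kappa> D \<rho> r t t' :: real and z :: 'a and C :: "'a set"
  defines "B \<equiv> D + \<rho>"
  defines "L \<equiv> 1 / \<kappa> + B / \<kappa>\<^sup>2"
  defines "A \<equiv> 12 * L + 4 * \<rho> / \<kappa>\<^sup>2"
  assumes pos: "0 < \<kappa>" "0 < D" "0 < \<rho>"
    and conn: "connected \<Gamma>" and r: "0 < r" "3 * r \<le> \<kappa>" "r \<le> 1"
    and t: "0 \<le> t" "t < t'" "t' \<le> \<rho>"
    and base: "\<And>\<tau>. 0 \<le> \<tau> \<Longrightarrow> \<tau> \<le> \<rho> \<Longrightarrow> z + \<tau> *\<^sub>R v \<notin> \<Gamma>"
    and bd: "\<And>u. u \<in> \<Gamma> \<Longrightarrow> norm (u - z) \<le> D"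
    and fin: "finite C"
    and C: "\<And>c. c \<in> C \<Longrightarrow> 2 * \<kappa> \<le> (c - z) \<bullet> n" "\<And>c. c \<in> C \<Longrightarrow> norm (c - z) \<le> D"
    and lat: "\<And>c. c \<in> C \<Longrightarrow> (c \<bullet> n) / r \<in> \<int>" "\<And>c. c \<in> C \<Longrightarrow> (c \<bullet> v) / r \<in> \<int>"
    and gl: "\<And>c. c \<in> C \<Longrightarrow> glimpsed \<Gamma> r (z + t *\<^sub>R v) c" "\<And>c. c \<in> C \<Longrightarrow> glimpsed \<Gamma> r (z + t' *\<^sub>R v) c"
  shows "real (card C) \<le> (A * D + 1) * (2 * A * D\<^sup>2 + \<rho>) * (16 * (B / (\<kappa> * A) + 1) + 6) / (r * (t' - t))"
proof -
  define d where "d = t' - t"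
  define h where "h = A * r"
  have d: "0 < d" "d \<le> \<rho>" using t by (auto simp: d_def)
  have Bp: "0 < B" using pos by (simp add: B_def)
  have Lp: "0 < L" using pos Bp by (simp add: L_def add_pos_pos)
  have Ap: "0 < A" "12 * L \<le> A" "4 * \<rho> / \<kappa>\<^sup>2 \<le> A" using pos Lp by (auto simp: A_def add_pos_pos)
  have hp: "0 < h" using Ap r by (simp add: h_def)
  have hL: "L * (3 * r) \<le> h / 4" using Ap r by (simp add: h_def)
  have h\<rho>: "4 * \<rho> / \<kappa>\<^sup>2 * r \<le> h" unfolding h_def using Ap r by (intro mult_right_mono) auto
  have vb: "\<bar>(u - z) \<bullet> v - \<tau>\<bar> \<le> B" if "norm (u - z) \<le> D" "0 \<le> \<tau>" "\<tau> \<le> \<rho>" for u \<tau>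
    using coord_le(2)[of "u - z"] that by (auto simp: B_def)
  have an: "(c - z) \<bullet> n \<le> D" if "c \<in> C" for c
    using coord_le(1)[of "c - z"] C(2)[OF that] by auto
  \<comment> \<open>The sign makes a larger first index mean a line of sight further away from the other
    observer, so that the triangle spanned by a point consists of the points with smaller indices.\<close>
  define ix where "ix c = (\<lfloor>- slope z t c / h\<rfloor>, \<lfloor>slope z t' c / h\<rfloor>)" for c
  define N where "N = \<lceil>B / (\<kappa> * h)\<rceil>"
  have N0: "0 \<le> N" unfolding N_def using pos hp Bp
    by (metis (no_types, opaque_lifting) ceiling_zero ceiling_mono divide_nonneg_nonneg less_imp_le mult_pos_pos)
  have slb: "\<bar>slope z \<tau> c / h\<bar> \<le> B / (\<kappa> * h)" if "c \<in> C" "0 \<le> \<tau>" "\<tau> \<le> \<rho>" for c \<tau>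
  proof -
    have "\<bar>slope z \<tau> c\<bar> \<le> B / \<kappa>"
      unfolding slope_def abs_divide
      using vb[OF C(2)[OF that(1)] that(2,3)] C(1)[OF that(1)] pos by (intro frac_le) auto
    then show ?thesis using hp pos by (simp add: divide_simps)
  qed
  have fl: "\<lfloor>x\<rfloor> \<in> {-N..N}" if "\<bar>x\<bar> \<le> B / (\<kappa> * h)" for x
  proof -
    have "-N = \<lfloor>- (B / (\<kappa> * h))\<rfloor>" by (simp add: N_def ceiling_def)
    also have "\<dots> \<le> \<lfloor>x\<rfloor>" using that by (intro floor_mono) auto
    finally have "-N \<le> \<lfloor>x\<rfloor>" .
    moreover have "\<lfloor>x\<rfloor> \<le> N" using that unfolding N_def by linarith
    ultimately show ?thesis by simp
  qed
  have sub: "ix ` C \<subseteq> {-N..N} \<times> {-N..N}"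
    using fl slb t by (fastforce simp: ix_def)
  have near: "\<kappa> \<le> (u - z) \<bullet> n" "0 \<le> \<tau> \<Longrightarrow> \<tau> \<le> \<rho> \<Longrightarrow> \<bar>slope z \<tau> u - slope z \<tau> c\<bar> \<le> h / 4"
    if c: "c \<in> C" and u: "u \<in> \<Gamma>" "dist u c \<le> 3 * r" for c u \<tau>
  proof -
    have "\<bar>(u - c) \<bullet> n\<bar> \<le> 3 * r" using coord_le(1)[of "u - c"] u(2) by (simp add: dist_norm)
    then show k: "\<kappa> \<le> (u - z) \<bullet> n" using C(1)[OF c] r by (simp add: inner_simps)
    assume \<tau>: "0 \<le> \<tau>" "\<tau> \<le> \<rho>"
    have "\<bar>slope z \<tau> u - slope z \<tau> c\<bar> \<le> L * dist u c"
      unfolding L_def using slope_lipschitz[OF pos(1) k _ vb[OF C(2)[OF c] \<tau>]] C(1)[OF c] pos by simp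
    also have "\<dots> \<le> L * (3 * r)" using Lp u by simp
    finally show "\<bar>slope z \<tau> u - slope z \<tau> c\<bar> \<le> h / 4" using hL by linarith
  qed
  have cS: "real (card (ix ` C)) \<le> 16 * real_of_int N + 6"
  proof (rule card_pattern_free[OF sub N0])
    fix i1 j1 i2 j2 i3 j3
    assume "(i1,j1) \<in> ix ` C" "(i2,j2) \<in> ix ` C" "(i3,j3) \<in> ix ` C"
      and o: "i1 + 2 \<le> i2" "i2 + 2 \<le> i3" "j1 + 2 \<le> j3" "j3 + 2 \<le> j2"
    then obtain c1 c2 c3 where c: "c1 \<in> C" "c2 \<in> C" "c3 \<in> C"
      and ixs: "(i1,j1) = ix c1" "(i2,j2) = ix c2" "(i3,j3) = ix c3" by blast
    obtain u1 where u1: "u1 \<in> \<Gamma>" "dist u1 c1 \<le> 3 * r"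
      using gl(1)[OF c(1)] by (auto simp: glimpsed_def nearly_visible_def)
    obtain u2 where u2: "nearly_visible \<Gamma> r (z + t *\<^sub>R v) u2" "dist u2 c2 \<le> 3 * r"
      using gl(1)[OF c(2)] by (auto simp: glimpsed_def)
    obtain u3 where u3: "nearly_visible \<Gamma> r (z + t' *\<^sub>R v) u3" "dist u3 c3 \<le> 3 * r"
      using gl(2)[OF c(3)] by (auto simp: glimpsed_def)
    have uG: "u2 \<in> \<Gamma>" "u3 \<in> \<Gamma>" using u2 u3 by (auto simp: nearly_visible_def)
    note n1 = near[OF c(1) u1] and n2 = near[OF c(2) uG(1) u2(2)] and n3 = near[OF c(3) uG(2) u3(2)]
    have t0: "0 \<le> t" "t \<le> \<rho>" "0 \<le> t'" "t' \<le> \<rho>" using t by auto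
    \<comment> \<open>Indices that differ by two belong to slopes that differ by more than h; passing from a grid point
      to a nearby point of the set costs at most h / 4 on each side.\<close>
    have "- slope z t c1 + h < - slope z t c2" "- slope z t c2 + h < - slope z t c3"
      "slope z t' c1 + h < slope z t' c3" "slope z t' c3 + h < slope z t' c2"
      by (intro floor_gap[OF hp]; use o ixs in \<open>simp add: ix_def\<close>)+
    then have g: "slope z t u2 < slope z t u1" "slope z t u3 + h / 2 \<le> slope z t u2"
      "slope z t' u1 < slope z t' u3" "slope z t' u3 + h / 2 \<le> slope z t' u2"
      using n1(2)[OF t0(1,2)] n2(2)[OF t0(1,2)] n3(2)[OF t0(1,2)]
        n1(2)[OF t0(3,4)] n2(2)[OF t0(3,4)] n3(2)[OF t0(3,4)] hp by argo+
    \<comment> \<open>The crossing lines of sight are those to u2 and to u3, and u1 lies in their triangle.\<close>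
    define \<mu> \<nu> where "\<mu> = slope z t u2" and "\<nu> = slope z t' u3"
    have nz: "(u1 - z) \<bullet> n > 0" "(u2 - z) \<bullet> n > 0" "(u3 - z) \<bullet> n > 0" using n1 n2 n3 pos by auto
    have m2: "d / ((u2 - z) \<bullet> n) + h / 2 \<le> \<mu> - \<nu>"
      using slope_diff[of u2 z t t'] nz g by (simp add: \<mu>_def \<nu>_def d_def)
    have m3: "d / ((u3 - z) \<bullet> n) + h / 2 \<le> \<mu> - \<nu>"
      using slope_diff[of u3 z t t'] nz g by (simp add: \<mu>_def \<nu>_def d_def)
    have "\<nu> < \<mu>" using m2 d nz hp
      by (smt (verit) divide_pos_pos half_gt_zero)
    show False
    proof (rule no_point_behind_wall[OF conn, of t t' z r u2 u3 "(u2 - z) \<bullet> n" "(u3 - z) \<bullet> n" \<mu> \<nu> u1])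
      show "z + \<tau> *\<^sub>R v \<notin> \<Gamma>" if "t \<le> \<tau>" "\<tau> \<le> t'" for \<tau> using base t that by auto
      show "(u2 - z) \<bullet> v - t = \<mu> * ((u2 - z) \<bullet> n)" unfolding \<mu>_def using nz by (intro slope_mult) auto
      show "(u3 - z) \<bullet> v - t' = \<nu> * ((u3 - z) \<bullet> n)" unfolding \<nu>_def using nz by (intro slope_mult) auto
      show "t' - t \<le> (\<mu> - \<nu>) * ((u2 - z) \<bullet> n - r)"
        using wall_is_short[OF pos(1) n2(1) d r(1) _ h\<rho> less_imp_le[OF hp] m2] r by (simp add: d_def)
      show "t' - t \<le> (\<mu> - \<nu>) * ((u3 - z) \<bullet> n - r)"
        using wall_is_short[OF pos(1) n3(1) d r(1) _ h\<rho> less_imp_le[OF hp] m3] r by (simp add: d_def)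
      show "\<mu> * ((u1 - z) \<bullet> n) < (u1 - z) \<bullet> v - t"
        using g(1) nz by (simp add: \<mu>_def slope_mult)
      show "(u1 - z) \<bullet> v - t' < \<nu> * ((u1 - z) \<bullet> n)"
        using g(3) nz by (simp add: \<nu>_def slope_mult)
    qed (use u1 u2 u3 nz r \<open>\<nu> < \<mu>\<close> in auto)
  qed
  define L1 where "L1 = nat \<lceil>2 * A * D\<^sup>2 / d\<rceil>"
  define L2 where "L2 = nat \<lceil>A * D\<rceil>"
  have fibre: "card {c \<in> C. ix c = s} \<le> L2 * L1" for s
  proof -
    define X where "X = {c \<in> C. ix c = s}"
    have finX: "finite X" using fin by (simp add: X_def)
    define p where "p c = \<lfloor>(c \<bullet> n) / r\<rfloor>" for c
    define q where "q c = \<lfloor>(c \<bullet> v) / r\<rfloor>" for c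
    have pr: "real_of_int (p c) * r = c \<bullet> n" "real_of_int (q c) * r = c \<bullet> v" if "c \<in> X" for c
      using lat[of c] that r by (auto simp: X_def p_def q_def field_simps elim!: Ints_cases)
    have sl: "\<bar>slope z t c - slope z t c'\<bar> < h" "\<bar>slope z t' c - slope z t' c'\<bar> < h"
      if "c \<in> X" "c' \<in> X" for c c'
    proof -
      have "ix c = ix c'" using that by (simp add: X_def)
      then have "\<lfloor>- slope z t c / h\<rfloor> = \<lfloor>- slope z t c' / h\<rfloor>" "\<lfloor>slope z t' c / h\<rfloor> = \<lfloor>slope z t' c' / h\<rfloor>"
        by (simp_all add: ix_def)
      then have "\<bar>- slope z t c / h - - slope z t c' / h\<bar> < 1" "\<bar>slope z t' c / h - slope z t' c' / h\<bar> < 1"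
        by (simp_all only: floor_same)
      then show "\<bar>slope z t c - slope z t c'\<bar> < h" "\<bar>slope z t' c - slope z t' c'\<bar> < h"
        using hp by (auto simp: abs_less_iff field_simps)
    qed
    have pX: "card (p ` X) \<le> L1"
    proof (rule card_int_spread)
      fix x y assume "x \<in> p ` X" "y \<in> p ` X"
      then obtain c c' where c: "c \<in> X" "c' \<in> X" "x = p c" "y = p c'" by auto
      define a a' where "a = (c - z) \<bullet> n" and "a' = (c' - z) \<bullet> n"
      have ap: "0 < a" "0 < a'" "a \<le> D" "a' \<le> D"
        using c C(1) an pos by (force simp: a_def a'_def X_def)+
      \<comment> \<open>Both slopes are known up to h, and d / a is their difference.\<close>
      have "\<bar>d / a - d / a'\<bar> < 2 * h"
        using slope_diff[of c z t t'] slope_diff[of c' z t t'] sl[OF c(1,2)] ap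
        unfolding d_def a_def a'_def by auto
      moreover have "d / a - d / a' = d * (a' - a) / (a * a')" using ap by (simp add: field_simps)
      ultimately have "d * (a' - a) / (a * a') < 2 * h" by (metis abs_less_iff)
      then have "d * (a' - a) < 2 * h * (a * a')" using ap by (simp add: pos_divide_less_eq)
      also have "\<dots> \<le> 2 * h * (D * D)" using hp ap by (intro mult_left_mono mult_mono) auto
      finally have "(a' - a) / r < 2 * A * D\<^sup>2 / d"
        using d r by (simp add: field_simps h_def power2_eq_square)
      moreover have "real_of_int (y - x) = (a' - a) / r"
        using pr c r by (simp add: a_def a'_def field_simps inner_simps)
      ultimately show "y - x < int L1" unfolding L1_def by linarith
    qed (use finX in simp)
    have "card X \<le> L2 * card (p ` X)"
    proof (rule card_le_fibres[where f = p])
      fix y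
      have "card (q ` {c \<in> X. p c = y}) \<le> L2"
      proof (rule card_int_spread)
        fix m m' assume "m \<in> q ` {c \<in> X. p c = y}" "m' \<in> q ` {c \<in> X. p c = y}"
        then obtain c c' where c: "c \<in> X" "c' \<in> X" "p c = p c'" "m = q c" "m' = q c'" by auto
        define a where "a = (c - z) \<bullet> n"
        have a: "a = (c' - z) \<bullet> n" "0 < a" "a \<le> D"
          using pr[OF c(1)] pr[OF c(2)] c an[of c] C(1)[of c] pos by (auto simp: a_def X_def inner_simps)
        have "slope z t c' - slope z t c = ((c' - c) \<bullet> v) / a"
          unfolding slope_def a(1)[symmetric] a_def[symmetric] diff_divide_distrib[symmetric]
          by (simp add: inner_simps)
        then have "((c' - c) \<bullet> v) / a < h" using sl(1)[OF c(1,2)] by auto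
        then have "(c' - c) \<bullet> v < h * a" using a by (simp add: field_simps)
        also have "\<dots> \<le> h * D" using a hp by simp
        finally have "(c' - c) \<bullet> v / r < A * D" using r by (simp add: h_def field_simps)
        moreover have "real_of_int (m' - m) = (c' - c) \<bullet> v / r"
          using pr c r by (simp add: field_simps inner_simps)
        ultimately show "m' - m < int L2" unfolding L2_def by linarith
      qed (use finX in simp)
      moreover have "inj_on q {c \<in> X. p c = y}"
      proof (rule inj_onI)
        fix c c' assume c: "c \<in> {c \<in> X. p c = y}" "c' \<in> {c \<in> X. p c = y}" "q c = q c'"
        then show "c = c'" using pr[of c] pr[of c'] by (intro frame_eqI) auto
      qed
      ultimately show "card {c \<in> X. p c = y} \<le> L2" by (simp add: card_image)
    qed (use finX in auto)
    also have "\<dots> \<le> L2 * L1" using pX by simp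
    finally show ?thesis by (simp add: X_def)
  qed
  have "card C \<le> L2 * L1 * card (ix ` C)"
    by (rule card_le_fibres[where f = ix]) (use fin fibre in auto)
  then have "real (card C) \<le> real L2 * real L1 * real (card (ix ` C))"
    by (metis of_nat_le_iff of_nat_mult)
  also have "\<dots> \<le> (A * D + 1) * ((2 * A * D\<^sup>2 + \<rho>) / d) * ((16 * (B / (\<kappa> * A) + 1) + 6) / r)"
  proof (intro mult_mono)
    show "real L2 \<le> A * D + 1" unfolding L2_def using Ap pos by (simp add: of_nat_nat)
    have "real L1 \<le> 2 * A * D\<^sup>2 / d + 1" unfolding L1_def using Ap pos d by (simp add: of_nat_nat)
    also have "\<dots> \<le> (2 * A * D\<^sup>2 + \<rho>) / d" using d by (simp add: field_simps)
    finally show "real L1 \<le> (2 * A * D\<^sup>2 + \<rho>) / d" .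
    have "real_of_int N \<le> B / (\<kappa> * h) + 1" unfolding N_def by linarith
    then have "real (card (ix ` C)) \<le> 16 * (B / (\<kappa> * h) + 1) + 6" using cS by argo
    also have "B / (\<kappa> * h) = B / (\<kappa> * A) / r" by (simp add: h_def)
    also have "16 * (B / (\<kappa> * A) / r + 1) + 6 \<le> (16 * (B / (\<kappa> * A) + 1) + 6) / r"
      using r by (simp add: field_simps)
    finally show "real (card (ix ` C)) \<le> (16 * (B / (\<kappa> * A) + 1) + 6) / r" .
  qed (use Ap pos d r Bp in auto)
  finally show ?thesis by (simp add: d_def mult.assoc mult.commute mult.left_commute)
qed

end

section \<open>Many observers on a segment\<close>

text \<open>
  Double counting and the inequality of Cauchy and Schwarz, with \<open>G i c\<close> read as
  \<open>observer i sees c\<close>.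
\<close>

lemma sum_card_squared_le:
  fixes M :: nat
  assumes "finite P"
  shows "(\<Sum>i<M. real (card {c \<in> P. G i c}))\<^sup>2
     \<le> real (card P) * (\<Sum>i<M. \<Sum>j<M. real (card {c \<in> P. G i c \<and> G j c}))"
proof -
  define g where "g i c = (of_bool (G i c) :: real)" for i c
  have cG: "real (card {c \<in> P. Q c}) = (\<Sum>c\<in>P. of_bool (Q c))" for Q
    using assms by (simp add: Int_def of_bool_def sum.If_cases)
  have "(\<Sum>i<M. real (card {c \<in> P. G i c}))\<^sup>2 = (\<Sum>c\<in>P. \<Sum>i<M. g i c)\<^sup>2"
    by (subst sum.swap) (simp add: cG g_def)
  also have "\<dots> \<le> real (card P) * (\<Sum>c\<in>P. (\<Sum>i<M. g i c)\<^sup>2)"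
    using sum_squared_le_sum_of_squares[of "\<lambda>c. \<Sum>i<M. g i c" P] by (simp add: mult.commute)
  also have "(\<Sum>c\<in>P. (\<Sum>i<M. g i c)\<^sup>2) = (\<Sum>c\<in>P. \<Sum>i<M. \<Sum>j<M. of_bool (G i c \<and> G j c))"
    unfolding power2_eq_square sum_product by (simp add: g_def of_bool_conj)
  also have "\<dots> = (\<Sum>i<M. \<Sum>c\<in>P. \<Sum>j<M. of_bool (G i c \<and> G j c))" by (rule sum.swap)
  also have "\<dots> = (\<Sum>i<M. \<Sum>j<M. \<Sum>c\<in>P. of_bool (G i c \<and> G j c))"
    by (intro sum.cong sum.swap refl)
  finally show ?thesis by (simp only: cG)
qed

text \<open>
  The value \<open>1\<close> on the diagonal accounts for the trivial bound on the number of points seen by one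
  observer, which has the same order as the bound for two neighbouring observers.
\<close>

definition inv_dist :: "nat \<Rightarrow> nat \<Rightarrow> real" where
  "inv_dist i j = (if i = j then 1 else 1 / \<bar>real i - real j\<bar>)"

lemma sum_inverse_dyadic: "(\<Sum>d<2^k. if d = 0 then 1 else 1 / real d) \<le> real k + 1"
proof (induction k)
  case (Suc k)
  let ?f = "\<lambda>d::nat. if d = 0 then 1 else 1 / real d"
  \<comment> \<open>The second half has 2^k terms, each at most 1 / 2^k.\<close>
  have split: "{..<2 ^ Suc k} = {..<2^k} \<union> {2^k..<2^k + 2^k :: nat}"
    by (simp add: ivl_disj_un_one(2) mult_2)
  have "sum ?f {..<2 ^ Suc k} = sum ?f {..<2^k} + sum ?f {2^k..<2^k + 2^k}"
    unfolding split by (rule sum.union_disjoint) auto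
  also have "sum ?f {2^k..<2^k + 2^k} \<le> (\<Sum>d\<in>{2^k..<2^k + 2^k :: nat}. 1 / 2^k)"
  proof (rule sum_mono)
    fix d :: nat assume "d \<in> {2^k..<2^k + 2^k}"
    then have "(2::nat)^k \<le> d" by simp
    then have "real (2^k) \<le> real d" by (rule of_nat_mono)
    then show "?f d \<le> 1 / 2^k"
      by (auto intro!: divide_left_mono mult_pos_pos simp: zero_less_mult_iff)
  qed
  also have "\<dots> = 1" by simp
  finally show ?case using Suc by simp
qed simp

lemma sum_inv_dist: "(\<Sum>i<2^k. \<Sum>j<2^k. inv_dist i j) \<le> 2^k * (2 * (real k + 1))"
proof -
  let ?f = "\<lambda>d::nat. if d = 0 then 1 else 1 / real d"
  have "(\<Sum>j<2^k. inv_dist i j) \<le> 2 * (real k + 1)" if "i < 2^k" for i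
  proof -
    have split: "{..<2^k} = {..i} \<union> {i<..<2^k}" using that by auto
    have "(\<Sum>j<2^k. inv_dist i j) = (\<Sum>j\<in>{..i}. inv_dist i j) + (\<Sum>j\<in>{i<..<2^k}. inv_dist i j)"
      unfolding split by (rule sum.union_disjoint) auto
    moreover have "(\<Sum>j\<in>{..i}. inv_dist i j) = (\<Sum>d\<in>(\<lambda>j. i - j) ` {..i}. ?f d)"
      by (subst sum.reindex) (auto simp: inj_on_def inv_dist_def of_nat_diff intro!: sum.cong)
    moreover have "\<dots> \<le> (\<Sum>d<2^k. ?f d)" using that by (intro sum_mono2) auto
    moreover have "(\<Sum>j\<in>{i<..<2^k}. inv_dist i j) = (\<Sum>d\<in>(\<lambda>j. j - i) ` {i<..<2^k}. ?f d)"
      by (subst sum.reindex) (auto simp: inj_on_def inv_dist_def of_nat_diff intro!: sum.cong)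
    moreover have "\<dots> \<le> (\<Sum>d<2^k. ?f d)" using that by (intro sum_mono2) auto
    ultimately show ?thesis using sum_inverse_dyadic[of k] by argo
  qed
  then have "(\<Sum>i<2^k. \<Sum>j<2^k. inv_dist i j) \<le> (\<Sum>i<(2::nat)^k. 2 * (real k + 1))"
    by (intro sum_mono) auto
  then show ?thesis by simp
qed

context frame
begin

lemma card_grid_in_ball:
  assumes fin: "finite C" and r: "0 < r" "r \<le> 1" and D: "0 < D" "\<And>c. c \<in> C \<Longrightarrow> norm (c - z) \<le> D"
    and lat: "\<And>c. c \<in> C \<Longrightarrow> (c \<bullet> n) / r \<in> \<int>" "\<And>c. c \<in> C \<Longrightarrow> (c \<bullet> v) / r \<in> \<int>"
  shows "real (card C) \<le> (2 * D + 2)\<^sup>2 / r\<^sup>2"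
proof -
  define L where "L = nat \<lceil>2 * D / r\<rceil> + 1"
  define p where "p c = \<lfloor>(c \<bullet> n) / r\<rfloor>" for c
  define q where "q c = \<lfloor>(c \<bullet> v) / r\<rfloor>" for c
  have pr: "real_of_int (p c) * r = c \<bullet> n" "real_of_int (q c) * r = c \<bullet> v" if "c \<in> C" for c
    using lat[of c] that r by (auto simp: p_def q_def field_simps elim!: Ints_cases)
  have df: "p c' - p c < int L" "q c' - q c < int L" if "c \<in> C" "c' \<in> C" for c c'
  proof -
    have "\<bar>(c' - z) \<bullet> n - (c - z) \<bullet> n\<bar> \<le> 2 * D" "\<bar>(c' - z) \<bullet> v - (c - z) \<bullet> v\<bar> \<le> 2 * D"
      using coord_le[of "c' - z"] coord_le[of "c - z"] D(2)[of c] D(2)[of c'] that by linarith+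
    then have "(real_of_int (p c' - p c)) * r \<le> 2 * D" "(real_of_int (q c' - q c)) * r \<le> 2 * D"
      using pr that by (auto simp: inner_simps algebra_simps abs_le_iff)
    then have "real_of_int (p c' - p c) \<le> 2 * D / r" "real_of_int (q c' - q c) \<le> 2 * D / r"
      using r by (simp_all add: field_simps)
    then show "p c' - p c < int L" "q c' - q c < int L" unfolding L_def by linarith+
  qed
  have "card C \<le> L * card (p ` C)"
  proof (rule card_le_fibres[where f = p])
    fix y
    have "card (q ` {c \<in> C. p c = y}) \<le> L"
      by (rule card_int_spread) (use df fin in auto)
    moreover have "inj_on q {c \<in> C. p c = y}"
    proof (rule inj_onI)
      fix c c' assume c: "c \<in> {c \<in> C. p c = y}" "c' \<in> {c \<in> C. p c = y}" "q c = q c'"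
      then show "c = c'" using pr[of c] pr[of c'] by (intro frame_eqI) auto
    qed
    ultimately show "card {c \<in> C. p c = y} \<le> L" by (simp add: card_image)
  qed (use fin in auto)
  also have "card (p ` C) \<le> L" by (rule card_int_spread) (use df fin in auto)
  finally have "real (card C) \<le> real L * real L" by (metis mult_le_mono2 of_nat_le_iff of_nat_mult)
  also have "\<dots> \<le> ((2 * D + 2) / r) * ((2 * D + 2) / r)"
  proof -
    have "real L = real_of_int \<lceil>2 * D / r\<rceil> + 1" using D r by (simp add: L_def of_nat_nat)
    then have "real L \<le> 2 * D / r + 2"
      using of_int_ceiling_le_add_one[of "2 * D / r"] by linarith
    also have "\<dots> \<le> (2 * D + 2) / r" using r by (simp add: field_simps)
    finally show ?thesis by (intro mult_mono) auto
  qed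
  finally show ?thesis by (simp add: power2_eq_square)
qed

text \<open>
  With \<open>r = 2^(-k)\<close>, observers \<open>i\<close> and \<open>j\<close> have distance \<open>\<rho> * \<bar>i - j\<bar> / 2^k\<close> and so see at most
  \<open>C * 4^k / \<bar>i - j\<bar>\<close> common points. Summing over all pairs gives \<open>C * 4^k\<close> times \<open>2^k * (k + 1)\<close>.
\<close>

lemma sum_card_glimpsed:
  fixes \<kappa> D \<rho> :: real
  assumes pos: "0 < \<kappa>" "0 < D" "0 < \<rho>"
  shows "\<exists>K\<ge>0. \<forall>\<Gamma> k z P. connected \<Gamma> \<longrightarrow> 3 * (1/2)^k \<le> \<kappa> \<longrightarrow>
     (\<forall>\<tau>. 0 \<le> \<tau> \<longrightarrow> \<tau> \<le> \<rho> \<longrightarrow> z + \<tau> *\<^sub>R v \<notin> \<Gamma>) \<longrightarrow> (\<forall>u\<in>\<Gamma>. norm (u - z) \<le> D) \<longrightarrow>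
     finite P \<longrightarrow> (\<forall>c\<in>P. 2 * \<kappa> \<le> (c - z) \<bullet> n \<and> norm (c - z) \<le> D \<and>
       (c \<bullet> n) / (1/2)^k \<in> \<int> \<and> (c \<bullet> v) / (1/2)^k \<in> \<int>) \<longrightarrow>
     (\<Sum>i<2^k. real (card {c \<in> P. glimpsed \<Gamma> ((1/2)^k) (z + (\<rho> * real i / 2^k) *\<^sub>R v) c}))\<^sup>2
       \<le> K * real (card P) * (8^k * (real k + 1))"
proof -
  define B where "B = D + \<rho>"
  define L where "L = 1 / \<kappa> + B / \<kappa>\<^sup>2"
  define A where "A = 12 * L + 4 * \<rho> / \<kappa>\<^sup>2"
  define K1 where "K1 = (A * D + 1) * (2 * A * D\<^sup>2 + \<rho>) * (16 * (B / (\<kappa> * A) + 1) + 6)"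
  define K2 where "K2 = K1 / \<rho> + (2 * D + 2)\<^sup>2"
  have "0 < A" using pos by (auto simp: A_def L_def B_def intro!: add_pos_pos)
  then have K1: "0 \<le> K1" using pos by (auto simp: K1_def B_def intro!: mult_nonneg_nonneg)
  have K2: "0 \<le> K2" using K1 pos by (simp add: K2_def)
  show ?thesis
  proof (intro exI[of _ "2 * K2"] conjI allI impI)
    show "0 \<le> 2 * K2" using K2 by simp
    fix \<Gamma> k z P
    assume conn: "connected \<Gamma>" and rk: "3 * (1/2)^k \<le> \<kappa>"
      and base: "\<forall>\<tau>. 0 \<le> \<tau> \<longrightarrow> \<tau> \<le> \<rho> \<longrightarrow> z + \<tau> *\<^sub>R v \<notin> \<Gamma>" and bd: "\<forall>u\<in>\<Gamma>. norm (u - z) \<le> D"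
      and fin: "finite P" and P: "\<forall>c\<in>P. 2 * \<kappa> \<le> (c - z) \<bullet> n \<and> norm (c - z) \<le> D \<and>
       (c \<bullet> n) / (1/2)^k \<in> \<int> \<and> (c \<bullet> v) / (1/2)^k \<in> \<int>"
    define r where "r = (1/2::real)^k"
    have r: "0 < r" "r \<le> 1" "3 * r \<le> \<kappa>" using rk by (auto simp: r_def power_le_one)
    have rM: "1 / r = 2^k" by (simp add: r_def power_divide)
    define G where "G i c \<longleftrightarrow> glimpsed \<Gamma> r (z + (\<rho> * real i / 2^k) *\<^sub>R v) c" for i c
    have p4: "(4::real)^k = 2^k * 2^k" by (simp flip: power_mult_distrib)
    have lt: "real (card {c \<in> P. G i c \<and> G j c}) \<le> K2 * 4^k * (1 / (real j - real i))"
      if "i < j" "j < 2^k" for i j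
    proof -
      have "real j \<le> real (2^k)" using that by (intro of_nat_mono) auto
      then have le: "\<rho> * real j / 2^k \<le> \<rho>" using pos by (simp add: field_simps)
      have "real (card {c \<in> P. G i c \<and> G j c}) \<le> K1 / (r * (\<rho> * real j / 2^k - \<rho> * real i / 2^k))"
        unfolding K1_def A_def L_def B_def
        by (rule card_commonly_glimpsed[OF pos conn r(1) r(3) r(2), where z = z])
          (use base bd fin P that pos le in \<open>auto simp: G_def r_def divide_strict_right_mono\<close>)
      also have "\<dots> = K1 * (1 / r) * 2^k / (\<rho> * (real j - real i))"
      proof -
        have "\<rho> * real j / 2^k - \<rho> * real i / 2^k = \<rho> * (real j - real i) / 2^k"
          by (simp add: right_diff_distrib diff_divide_distrib)
        then show ?thesis by simp
      qed
      also have "\<dots> = K1 / \<rho> * 4^k * (1 / (real j - real i))"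
        unfolding rM p4 by simp
      also have "\<dots> \<le> K2 * 4^k * (1 / (real j - real i))"
        using that by (intro mult_right_mono) (auto simp: K2_def)
      finally show ?thesis .
    qed
    have eq: "real (card {c \<in> P. G i c}) \<le> K2 * 4^k" for i
    proof -
      have "real (card {c \<in> P. G i c}) \<le> (2 * D + 2)\<^sup>2 / r\<^sup>2"
        by (rule card_grid_in_ball[where z = z]) (use r pos P fin in \<open>auto simp: r_def\<close>)
      also have "\<dots> = (2 * D + 2)\<^sup>2 * (1 / r)\<^sup>2" by (simp add: power_divide)
      also have "\<dots> = (2 * D + 2)\<^sup>2 * 4^k" unfolding rM p4 by (simp add: power2_eq_square)
      also have "\<dots> \<le> K2 * 4^k" using K1 pos by (intro mult_right_mono) (auto simp: K2_def)
      finally show ?thesis .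
    qed
    have pair: "real (card {c \<in> P. G i c \<and> G j c}) \<le> K2 * 4^k * inv_dist i j"
      if "i < 2^k" "j < 2^k" for i j
    proof (cases i j rule: linorder_cases)
      case less
      then show ?thesis using lt[OF less that(2)] by (simp add: inv_dist_def abs_if)
    next
      case equal
      then show ?thesis using eq[of i] by (simp add: inv_dist_def)
    next
      case greater
      then show ?thesis using lt[OF greater that(1)] by (simp add: inv_dist_def abs_if conj_commute)
    qed
    have "(\<Sum>i<2^k. real (card {c \<in> P. G i c}))\<^sup>2
       \<le> real (card P) * (\<Sum>i<2^k. \<Sum>j<2^k. real (card {c \<in> P. G i c \<and> G j c}))"
      by (rule sum_card_squared_le[OF fin])
    also have "\<dots> \<le> real (card P) * (\<Sum>i<2^k. \<Sum>j<2^k. K2 * 4^k * inv_dist i j)"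
      using pair by (intro mult_left_mono sum_mono) auto
    also have "(\<Sum>i<2^k. \<Sum>j<2^k. K2 * 4^k * inv_dist i j)
        = K2 * 4^k * (\<Sum>i<2^k. \<Sum>j<2^k. inv_dist i j)"
      by (simp add: sum_distrib_left)
    also have "real (card P) * \<dots> \<le> real (card P) * (K2 * 4^k * (2^k * (2 * (real k + 1))))"
      using sum_inv_dist K2 by (intro mult_left_mono) auto
    also have "\<dots> = 2 * K2 * real (card P) * (8^k * (real k + 1))"
    proof -
      have "(8::real)^k = 4^k * 2^k" by (simp flip: power_mult_distrib)
      then show ?thesis by simp
    qed
    finally show "(\<Sum>i<2^k. real (card {c \<in> P. glimpsed \<Gamma> ((1/2)^k) (z + (\<rho> * real i / 2^k) *\<^sub>R v) c}))\<^sup>2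
       \<le> 2 * K2 * real (card P) * (8^k * (real k + 1))"
      by (simp add: G_def r_def)
  qed
qed

end

section \<open>Averages over a ball of observers\<close>

text \<open>
  Translating the integrand by \<open>t i *\<^sub>R v\<close> moves the ball of radius \<open>\<rho>\<close> within the ball of radius
  \<open>2 * \<rho>\<close>, so each of the \<open>M\<close> translates has at least the original integral over the larger ball.
  This replaces an integration along lines by a finite average.
\<close>

lemma nn_integral_ball_le_averages:
  fixes f :: "'a::euclidean_space \<Rightarrow> ennreal"
  assumes f[measurable]: "f \<in> borel_measurable borel" and v: "norm v = 1"
    and t: "\<And>i. i < M \<Longrightarrow> 0 \<le> t i \<and> t i \<le> \<rho>"
    and Q: "\<And>z. z \<in> ball x0 (2 * \<rho>) \<Longrightarrow> (\<Sum>i<M. f (z + t i *\<^sub>R v)) \<le> Q"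
  shows "of_nat M * (\<integral>\<^sup>+x. f x * indicator (ball x0 \<rho>) x \<partial>lborel) \<le> Q * emeasure lborel (ball x0 (2 * \<rho>))"
proof -
  have [measurable]: "ball x0 e \<in> sets borel" for e by (rule borel_open) simp
  have shift: "(\<integral>\<^sup>+x. f x * indicator (ball x0 \<rho>) x \<partial>lborel)
      \<le> (\<integral>\<^sup>+z. f (z + t i *\<^sub>R v) * indicator (ball x0 (2 * \<rho>)) z \<partial>lborel)" if "i < M" for i
  proof -
    have "(\<integral>\<^sup>+x. f x * indicator (ball x0 \<rho>) x \<partial>lborel)
      = (\<integral>\<^sup>+x. f x * indicator (ball x0 \<rho>) x \<partial>distr lborel borel ((+) (t i *\<^sub>R v)))"
      by (simp only: lborel_distr_plus)
    also have "\<dots> = (\<integral>\<^sup>+z. f (t i *\<^sub>R v + z) * indicator (ball x0 \<rho>) (t i *\<^sub>R v + z) \<partial>lborel)"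
      by (rule nn_integral_distr) measurable
    also have "\<dots> \<le> (\<integral>\<^sup>+z. f (z + t i *\<^sub>R v) * indicator (ball x0 (2 * \<rho>)) z \<partial>lborel)"
    proof (rule nn_integral_mono)
      fix z
      have "z \<in> ball x0 (2 * \<rho>)" if "t i *\<^sub>R v + z \<in> ball x0 \<rho>"
      proof -
        have "dist x0 z \<le> dist x0 (t i *\<^sub>R v + z) + norm (t i *\<^sub>R v)"
          using dist_triangle[of x0 z "t i *\<^sub>R v + z"] by (simp add: dist_norm)
        also have "\<dots> < 2 * \<rho>" using that t[OF \<open>i < M\<close>] v by auto
        finally show ?thesis by simp
      qed
      then show "f (t i *\<^sub>R v + z) * indicator (ball x0 \<rho>) (t i *\<^sub>R v + z)
          \<le> f (z + t i *\<^sub>R v) * indicator (ball x0 (2 * \<rho>)) z"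
        by (auto simp: indicator_def add.commute)
    qed
    finally show ?thesis .
  qed
  have "of_nat M * (\<integral>\<^sup>+x. f x * indicator (ball x0 \<rho>) x \<partial>lborel)
      = (\<Sum>i<M. \<integral>\<^sup>+x. f x * indicator (ball x0 \<rho>) x \<partial>lborel)" by simp
  also have "\<dots> \<le> (\<Sum>i<M. \<integral>\<^sup>+z. f (z + t i *\<^sub>R v) * indicator (ball x0 (2 * \<rho>)) z \<partial>lborel)"
    using shift by (intro sum_mono) auto
  also have "\<dots> = (\<integral>\<^sup>+z. (\<Sum>i<M. f (z + t i *\<^sub>R v) * indicator (ball x0 (2 * \<rho>)) z) \<partial>lborel)"
    by (subst nn_integral_sum) auto
  also have "\<dots> \<le> (\<integral>\<^sup>+z. Q * indicator (ball x0 (2 * \<rho>)) z \<partial>lborel)"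
    using Q by (intro nn_integral_mono) (auto simp: indicator_def)
  also have "\<dots> = Q * emeasure lborel (ball x0 (2 * \<rho>))"
    by (subst nn_integral_cmult_indicator) auto
  finally show ?thesis .
qed

text \<open>
  Observers are \<open>z + t v\<close> with \<open>z\<close> in the ball of radius \<open>R / 4\<close> and \<open>0 \<le> t \<le> R / 8\<close>. They stay in
  the ball that avoids \<open>\<Gamma>\<close>, and all points of \<open>P\<close> have \<open>n\<close>-distance at least \<open>R / 4\<close> from their
  line, which keeps the slopes under control.
\<close>

lemma (in frame) nn_integral_card_glimpsed_half_plane:
  assumes comp: "compact \<Gamma>" and conn: "connected \<Gamma>" and R: "0 < R" and disj: "ball x0 R \<inter> \<Gamma> = {}"
    and D: "\<And>u. u \<in> \<Gamma> \<Longrightarrow> norm (u - x0) \<le> D"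
  shows "\<exists>K\<ge>0. \<forall>k P. 3 * (1/2)^k \<le> R / 8 \<longrightarrow> finite P \<longrightarrow>
    (\<forall>c\<in>P. R / 2 \<le> (c - x0) \<bullet> n \<and> norm (c - x0) \<le> D \<and>
       (c \<bullet> n) / (1/2)^k \<in> \<int> \<and> (c \<bullet> v) / (1/2)^k \<in> \<int>) \<longrightarrow>
    (\<integral>\<^sup>+x. ennreal (real (card {c \<in> P. glimpsed \<Gamma> ((1/2)^k) x c})) * indicator (ball x0 (R / 8)) x \<partial>lborel)
      \<le> ennreal (K * sqrt (real (card P) * (2^k * (real k + 1))))"
proof -
  define D' where "D' = \<bar>D\<bar> + R"
  have "0 < R / 8" "0 < D'" using R by (auto simp: D'_def)
  then obtain K where K: "0 \<le> K" and main: "\<And>\<Gamma> k z P. connected \<Gamma> \<Longrightarrow> 3 * (1/2)^k \<le> R / 8 \<Longrightarrow>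
     (\<forall>\<tau>. 0 \<le> \<tau> \<longrightarrow> \<tau> \<le> R / 8 \<longrightarrow> z + \<tau> *\<^sub>R v \<notin> \<Gamma>) \<Longrightarrow> (\<forall>u\<in>\<Gamma>. norm (u - z) \<le> D') \<Longrightarrow>
     finite P \<Longrightarrow> (\<forall>c\<in>P. 2 * (R / 8) \<le> (c - z) \<bullet> n \<and> norm (c - z) \<le> D' \<and>
       (c \<bullet> n) / (1/2)^k \<in> \<int> \<and> (c \<bullet> v) / (1/2)^k \<in> \<int>) \<Longrightarrow>
     (\<Sum>i<2^k. real (card {c \<in> P. glimpsed \<Gamma> ((1/2)^k) (z + (R / 8 * real i / 2^k) *\<^sub>R v) c}))\<^sup>2
       \<le> K * real (card P) * (8^k * (real k + 1))"
    using sum_card_glimpsed[of "R / 8" D' "R / 8"] by blast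
  define V where "V = measure lborel (ball x0 (2 * (R / 8)))"
  have V: "emeasure lborel (ball x0 (2 * (R / 8))) = ennreal V" "0 \<le> V"
    using emeasure_bounded_finite[of "ball x0 (2 * (R / 8))"]
    by (auto simp: V_def emeasure_eq_ennreal_measure less_top)
  show ?thesis
  proof (intro exI[of _ "V * sqrt K"] conjI allI impI)
    show "0 \<le> V * sqrt K" using V K by simp
    fix k P
    assume k: "3 * (1/2)^k \<le> R / 8" and fin: "finite P"
      and P: "\<forall>c\<in>P. R / 2 \<le> (c - x0) \<bullet> n \<and> norm (c - x0) \<le> D \<and>
       (c \<bullet> n) / (1/2)^k \<in> \<int> \<and> (c \<bullet> v) / (1/2)^k \<in> \<int>"
    define N where "N x = real (card {c \<in> P. glimpsed \<Gamma> ((1/2)^k) x c})" for x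
    define Q where "Q = sqrt (K * real (card P) * (8^k * (real k + 1)))"
    define I where "I = (\<integral>\<^sup>+x. ennreal (N x) * indicator (ball x0 (R / 8)) x \<partial>lborel)"
    have avg: "(\<Sum>i<2^k. ennreal (N (z + (R / 8 * real i / 2^k) *\<^sub>R v))) \<le> ennreal Q"
      if z: "z \<in> ball x0 (2 * (R / 8))" for z
    proof -
      have zx: "norm (z - x0) < R / 4" using z by (simp add: dist_norm norm_minus_commute)
      have tri: "norm (u - z) \<le> norm (u - x0) + norm (z - x0)" for u
        using norm_triangle_ineq4[of "u - x0" "z - x0"] by simp
      have "(\<Sum>i<2^k. N (z + (R / 8 * real i / 2^k) *\<^sub>R v))\<^sup>2 \<le> K * real (card P) * (8^k * (real k + 1))"
        unfolding N_def
      proof (rule main[OF conn k _ _ fin])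
        show "\<forall>\<tau>. 0 \<le> \<tau> \<longrightarrow> \<tau> \<le> R / 8 \<longrightarrow> z + \<tau> *\<^sub>R v \<notin> \<Gamma>"
        proof (intro allI impI)
          fix \<tau> :: real assume "0 \<le> \<tau>" "\<tau> \<le> R / 8"
          then have "norm ((z - x0) + \<tau> *\<^sub>R v) < R"
            using norm_triangle_ineq[of "z - x0" "\<tau> *\<^sub>R v"] zx norms R by simp
          then have "z + \<tau> *\<^sub>R v \<in> ball x0 R" by (simp add: dist_norm norm_minus_commute algebra_simps)
          then show "z + \<tau> *\<^sub>R v \<notin> \<Gamma>" using disj by blast
        qed
        show "\<forall>u\<in>\<Gamma>. norm (u - z) \<le> D'"
        proof
          fix u assume "u \<in> \<Gamma>"
          then show "norm (u - z) \<le> D'" using D[of u] tri[of u] zx R by (simp add: D'_def)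
        qed
        show "\<forall>c\<in>P. 2 * (R / 8) \<le> (c - z) \<bullet> n \<and> norm (c - z) \<le> D' \<and>
           (c \<bullet> n) / (1/2)^k \<in> \<int> \<and> (c \<bullet> v) / (1/2)^k \<in> \<int>"
        proof (intro ballI)
          fix c assume c: "c \<in> P"
          have "(c - z) \<bullet> n = (c - x0) \<bullet> n - (z - x0) \<bullet> n" by (simp add: inner_simps)
          moreover have "\<bar>(z - x0) \<bullet> n\<bar> < R / 4" using coord_le(1)[of "z - x0"] zx by linarith
          moreover have "R / 2 \<le> (c - x0) \<bullet> n" "norm (c - x0) \<le> D" using P c by auto
          ultimately have "2 * (R / 8) \<le> (c - z) \<bullet> n" "norm (c - z) \<le> D'"
            using tri[of c] zx R by (auto simp: D'_def)
          then show "2 * (R / 8) \<le> (c - z) \<bullet> n \<and> norm (c - z) \<le> D' \<and>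
           (c \<bullet> n) / (1/2)^k \<in> \<int> \<and> (c \<bullet> v) / (1/2)^k \<in> \<int>" using P c by simp
        qed
      qed
      then have "(\<Sum>i<2^k. N (z + (R / 8 * real i / 2^k) *\<^sub>R v)) \<le> Q"
        unfolding Q_def by (rule real_le_rsqrt)
      then have "ennreal (\<Sum>i<2^k. N (z + (R / 8 * real i / 2^k) *\<^sub>R v)) \<le> ennreal Q"
        by (rule ennreal_leI)
      then show ?thesis by (simp add: N_def)
    qed
    have "of_nat (2^k) * I \<le> ennreal Q * emeasure lborel (ball x0 (2 * (R / 8)))"
      unfolding I_def
    proof (rule nn_integral_ball_le_averages[where t = "\<lambda>i. R / 8 * real i / 2^k" and v = v])
      show "(\<lambda>x. ennreal (N x)) \<in> borel_measurable borel"
        unfolding N_def by (rule card_glimpsed_measurable[OF comp fin])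
      fix i :: nat assume "i < 2^k"
      then have "real i \<le> real (2^k)" by (intro of_nat_mono) auto
      then have "R / 8 * real i \<le> R / 8 * 2^k" using R by (intro mult_left_mono) auto
      then show "0 \<le> R / 8 * real i / 2^k \<and> R / 8 * real i / 2^k \<le> R / 8"
        using R by (simp add: divide_le_eq)
    qed (use norms avg in auto)
    also have "\<dots> = ennreal (Q * V)" unfolding V(1) using K by (simp add: ennreal_mult' Q_def)
    finally have le: "of_nat (2^k) * I \<le> ennreal (Q * V)" .
    have "I = ennreal (1 / 2^k) * (ennreal (2^k) * I)"
      unfolding mult.assoc[symmetric] by (subst ennreal_mult[symmetric]) auto
    also have "ennreal (2^k) * I = of_nat (2^k) * I" by (simp add: ennreal_power[symmetric])
    also have "ennreal (1 / 2^k) * (of_nat (2^k) * I) \<le> ennreal (1 / 2^k) * ennreal (Q * V)"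
      by (intro mult_left_mono le) auto
    also have "\<dots> = ennreal (1 / 2^k * (Q * V))" by (rule ennreal_mult'[symmetric]) simp
    also have "1 / 2^k * (Q * V) = V * sqrt K * sqrt (real (card P) * (2^k * (real k + 1)))"
    proof -
      have "(8::real)^k = (2^k)\<^sup>2 * 2^k"
        by (simp add: power2_eq_square flip: power_mult_distrib)
      then have "K * real (card P) * (8^k * (real k + 1))
          = (2^k)\<^sup>2 * (K * (real (card P) * (2^k * (real k + 1))))" by simp
      \<comment> \<open>Dividing by the number of observers turns the square root of 8^k into that of 2^k.\<close>
      then have "Q = 2^k * (sqrt K * sqrt (real (card P) * (2^k * (real k + 1))))"
        unfolding Q_def by (simp only: real_sqrt_mult real_sqrt_abs) simp
      then show ?thesis by simp
    qed
    finally show "(\<integral>\<^sup>+x. ennreal (real (card {c \<in> P. glimpsed \<Gamma> ((1/2)^k) x c})) * indicator (ball x0 (R / 8)) x \<partial>lborel)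
      \<le> ennreal (V * sqrt K * sqrt (real (card P) * (2^k * (real k + 1))))"
      unfolding I_def N_def .
  qed
qed

lemma frame_axes:
  assumes "i \<noteq> j" "\<sigma> = 1 \<or> \<sigma> = -1"
  shows "frame (\<sigma> *\<^sub>R axis i 1 :: real^2) (axis j 1)"
proof
  have ij: "i = 1 \<and> j = 2 \<or> i = 2 \<and> j = 1" using assms(1) exhaust_2[of i] exhaust_2[of j] by auto
  show "(\<sigma> *\<^sub>R axis i 1 :: real^2) \<bullet> (\<sigma> *\<^sub>R axis i 1) = 1" using assms(2) by (auto simp: inner_axis_axis)
  show "(axis j 1 :: real^2) \<bullet> axis j 1 = 1" by (simp add: inner_axis_axis)
  show "(\<sigma> *\<^sub>R axis i 1 :: real^2) \<bullet> axis j 1 = 0" using assms(1) by (simp add: inner_axis_axis)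
  show "u = (u \<bullet> \<sigma> *\<^sub>R axis i 1) *\<^sub>R \<sigma> *\<^sub>R axis i 1 + (u \<bullet> axis j 1) *\<^sub>R axis j 1" for u :: "real^2"
    using ij assms(2) by (auto simp: inner_axis) (auto simp: vec_eq_iff forall_2 axis_def)
qed

definition grid :: "nat \<Rightarrow> (real^2) set" where
  "grid k = {c. \<forall>i. c $ i / (1/2)^k \<in> \<int>}"

text \<open>
  The half planes at distance \<open>R / 2\<close> from \<open>x0\<close> in the four axis directions contain every grid
  point that can be glimpsed, as such a point is near \<open>\<Gamma>\<close> and so has distance almost \<open>R\<close> from
  \<open>x0\<close>. The line of the observers is chosen perpendicular to the axis direction of the half plane.
\<close>

lemma nn_integral_card_glimpsed:
  fixes \<Gamma> :: "(real^2) set"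
  assumes comp: "compact \<Gamma>" and conn: "connected \<Gamma>" and R: "0 < R" and disj: "ball x0 R \<inter> \<Gamma> = {}"
  shows "\<exists>K\<ge>0. \<forall>k P. 3 * (1/2)^k \<le> R / 8 \<longrightarrow> finite P \<longrightarrow> P \<subseteq> grid k \<longrightarrow>
    (\<integral>\<^sup>+x. ennreal (real (card {c \<in> P. glimpsed \<Gamma> ((1/2)^k) x c})) * indicator (ball x0 (R / 8)) x \<partial>lborel)
      \<le> ennreal (K * sqrt (real (card P) * (2^k * (real k + 1))))"
proof -
  obtain D where D0: "\<And>u. u \<in> \<Gamma> \<Longrightarrow> norm (u - x0) \<le> D"
    using compact_imp_bounded[OF comp] unfolding bounded_any_center[where a = x0]
    by (auto simp: dist_norm norm_minus_commute)
  define D' where "D' = D + R"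
  have D: "norm (u - x0) \<le> D'" if "u \<in> \<Gamma>" for u using D0[OF that] R by (simp add: D'_def)
  define dirs where "dirs = ({1,-1} \<times> UNIV :: (real \<times> 2) set)"
  define nrm where "nrm s = (fst s *\<^sub>R axis (snd s) 1 :: real^2)" for s :: "real \<times> 2"
  define H where "H s P = {c \<in> P. R / 2 \<le> (c - x0) \<bullet> nrm s \<and> norm (c - x0) \<le> D'}" for s P
  have "\<forall>s\<in>dirs. \<exists>K\<ge>0. \<forall>k P. 3 * (1/2)^k \<le> R / 8 \<longrightarrow> finite P \<longrightarrow> P \<subseteq> grid k \<longrightarrow>
    (\<integral>\<^sup>+x. ennreal (real (card {c \<in> H s P. glimpsed \<Gamma> ((1/2)^k) x c})) * indicator (ball x0 (R / 8)) x \<partial>lborel)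
      \<le> ennreal (K * sqrt (real (card P) * (2^k * (real k + 1))))"
  proof
    fix s assume s: "s \<in> dirs"
    obtain \<sigma> i where si: "s = (\<sigma>, i)" "\<sigma> = 1 \<or> \<sigma> = -1" using s by (auto simp: dirs_def)
    define j :: 2 where "j = (if i = 1 then 2 else 1)"
    have j: "i \<noteq> j" by (simp add: j_def)
    interpret frame "nrm s" "axis j 1" unfolding nrm_def si(1) using frame_axes[OF j si(2)] by simp
    obtain K where K: "K \<ge> 0" and *: "\<And>k P. 3 * (1/2)^k \<le> R / 8 \<Longrightarrow> finite P \<Longrightarrow>
      (\<forall>c\<in>P. R / 2 \<le> (c - x0) \<bullet> nrm s \<and> norm (c - x0) \<le> D' \<and>
       (c \<bullet> nrm s) / (1/2)^k \<in> \<int> \<and> (c \<bullet> axis j 1) / (1/2)^k \<in> \<int>) \<Longrightarrow>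
      (\<integral>\<^sup>+x. ennreal (real (card {c \<in> P. glimpsed \<Gamma> ((1/2)^k) x c})) * indicator (ball x0 (R / 8)) x \<partial>lborel)
      \<le> ennreal (K * sqrt (real (card P) * (2^k * (real k + 1))))"
      using nn_integral_card_glimpsed_half_plane[OF comp conn R disj D] by blast
    show "\<exists>K\<ge>0. \<forall>k P. 3 * (1/2)^k \<le> R / 8 \<longrightarrow> finite P \<longrightarrow> P \<subseteq> grid k \<longrightarrow>
    (\<integral>\<^sup>+x. ennreal (real (card {c \<in> H s P. glimpsed \<Gamma> ((1/2)^k) x c})) * indicator (ball x0 (R / 8)) x \<partial>lborel)
      \<le> ennreal (K * sqrt (real (card P) * (2^k * (real k + 1))))"
    proof (intro exI[of _ K] conjI K allI impI)
      fix k P assume a: "3 * (1/2)^k \<le> R / 8" "finite P" "P \<subseteq> grid k"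
      have "(c \<bullet> nrm s) / (1/2)^k \<in> \<int>" "(c \<bullet> axis j 1) / (1/2)^k \<in> \<int>" if "c \<in> P" for c
      proof -
        have g: "c $ l / (1/2)^k \<in> \<int>" for l using a(3) that by (auto simp: grid_def)
        show "(c \<bullet> axis j 1) / (1/2)^k \<in> \<int>" using g[of j] by (simp add: inner_axis)
        show "(c \<bullet> nrm s) / (1/2)^k \<in> \<int>" using g[of i] si Ints_minus[OF g[of i]]
          by (auto simp: nrm_def inner_axis)
      qed
      then have "(\<integral>\<^sup>+x. ennreal (real (card {c \<in> H s P. glimpsed \<Gamma> ((1/2)^k) x c})) * indicator (ball x0 (R / 8)) x \<partial>lborel)
        \<le> ennreal (K * sqrt (real (card (H s P)) * (2^k * (real k + 1))))"
        by (intro *) (use a in \<open>auto simp: H_def\<close>)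
      also have "\<dots> \<le> ennreal (K * sqrt (real (card P) * (2^k * (real k + 1))))"
        using a K by (intro ennreal_leI mult_left_mono real_sqrt_le_mono mult_right_mono of_nat_mono card_mono)
          (auto simp: H_def)
      finally show "(\<integral>\<^sup>+x. ennreal (real (card {c \<in> H s P. glimpsed \<Gamma> ((1/2)^k) x c})) * indicator (ball x0 (R / 8)) x \<partial>lborel)
        \<le> ennreal (K * sqrt (real (card P) * (2^k * (real k + 1))))" .
    qed
  qed
  from bchoice[OF this] obtain K where K: "\<And>s. s \<in> dirs \<Longrightarrow> 0 \<le> K s" and KI: "\<And>s k P. s \<in> dirs \<Longrightarrow> 3 * (1/2)^k \<le> R / 8 \<Longrightarrow> finite P \<Longrightarrow> P \<subseteq> grid k \<Longrightarrow>
    (\<integral>\<^sup>+x. ennreal (real (card {c \<in> H s P. glimpsed \<Gamma> ((1/2)^k) x c})) * indicator (ball x0 (R / 8)) x \<partial>lborel)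
      \<le> ennreal (K s * sqrt (real (card P) * (2^k * (real k + 1))))"
    by blast
  have findirs: "finite dirs" by (simp add: dirs_def)
  show ?thesis
  proof (intro exI[of _ "\<Sum>s\<in>dirs. K s"] conjI allI impI)
    show "0 \<le> (\<Sum>s\<in>dirs. K s)" using K by (rule sum_nonneg)
    fix k P assume a: "3 * (1/2)^k \<le> R / 8" "finite P" "P \<subseteq> grid k"
    let ?r = "(1/2::real)^k"
    have cover: "\<exists>s\<in>dirs. c \<in> H s P" if "c \<in> P" and gl: "glimpsed \<Gamma> ?r x c" for c x
    proof -
      obtain u where u: "u \<in> \<Gamma>" "dist u c \<le> 3 * ?r"
        using gl by (auto simp: glimpsed_def nearly_visible_def)
      have far: "R \<le> norm (u - x0)"
        using disj u(1) by (auto simp: disjoint_iff dist_norm norm_minus_commute simp flip: not_less)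
      \<comment> \<open>The constant 7 / 10 is less than 1 / sqrt 2 but still leaves R / 2 after a loss of R / 8.\<close>
      have "\<exists>i. 7 / 10 * R \<le> \<bar>(u - x0) $ i\<bar>"
      proof (rule ccontr)
        assume "\<nexists>i. 7 / 10 * R \<le> \<bar>(u - x0) $ i\<bar>"
        then have sm: "\<bar>(u - x0) $ i\<bar> < 7 / 10 * R" for i by (auto simp: not_le)
        have nsq: "(norm w)\<^sup>2 = (w $ 1)\<^sup>2 + (w $ 2)\<^sup>2" for w :: "real^2"
          unfolding power2_norm_eq_inner by (simp add: inner_vec_def sum_2 power2_eq_square)
        have sq: "((u - x0) $ i)\<^sup>2 \<le> (7 / 10 * R)\<^sup>2" for i
          using power_mono[OF less_imp_le[OF sm[of i]] abs_ge_zero, of 2] by (simp only: power2_abs)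
        have "(norm (u - x0))\<^sup>2 \<le> 2 * (7 / 10 * R)\<^sup>2"
          unfolding nsq mult_2 by (intro add_mono sq)
        also have "\<dots> < R\<^sup>2" using R by (simp add: power2_eq_square)
        also have "R\<^sup>2 \<le> (norm (u - x0))\<^sup>2" using far R by (intro power_mono) auto
        finally show False by simp
      qed
      then obtain i where i: "7 / 10 * R \<le> \<bar>(u - x0) $ i\<bar>" by blast
      have "\<bar>(u - c) $ i\<bar> \<le> R / 8" using component_le_norm_cart[of "u - c" i] u(2) a(1)
        by (simp add: dist_norm)
      moreover have "(u - x0) $ i = (u - c) $ i + (c - x0) $ i" by simp
      ultimately have big: "R / 2 \<le> \<bar>(c - x0) $ i\<bar>" using i R by linarith
      define \<sigma> where "\<sigma> = (if 0 \<le> (c - x0) $ i then 1 else -1 :: real)"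
      have "(c - x0) \<bullet> nrm (\<sigma>, i) = \<sigma> * (c - x0) $ i"
        by (simp add: nrm_def inner_axis)
      also have "\<dots> = \<bar>(c - x0) $ i\<bar>" by (simp only: \<sigma>_def abs_if) simp
      finally have "R / 2 \<le> (c - x0) \<bullet> nrm (\<sigma>, i)" using big by simp
      moreover have "norm (c - x0) \<le> D'"
        using norm_triangle_ineq4[of "u - x0" "u - c"] D0[OF u(1)] u(2) a(1) R
        by (simp add: D'_def dist_norm)
      ultimately have "c \<in> H (\<sigma>, i) P" using that(1) by (simp add: H_def)
      then show ?thesis by (intro bexI[of _ "(\<sigma>, i)"]) (auto simp: dirs_def \<sigma>_def)
    qed
    have cards: "real (card {c \<in> P. glimpsed \<Gamma> ?r x c}) \<le> (\<Sum>s\<in>dirs. real (card {c \<in> H s P. glimpsed \<Gamma> ?r x c}))" for x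
    proof -
      have "{c \<in> P. glimpsed \<Gamma> ?r x c} \<subseteq> (\<Union>s\<in>dirs. {c \<in> H s P. glimpsed \<Gamma> ?r x c})"
        using cover by blast
      then have "card {c \<in> P. glimpsed \<Gamma> ?r x c} \<le> card (\<Union>s\<in>dirs. {c \<in> H s P. glimpsed \<Gamma> ?r x c})"
        using a(2) findirs by (intro card_mono) (auto simp: H_def)
      also have "\<dots> \<le> (\<Sum>s\<in>dirs. card {c \<in> H s P. glimpsed \<Gamma> ?r x c})"
        by (rule card_UN_le[OF findirs])
      finally have "real (card {c \<in> P. glimpsed \<Gamma> ?r x c})
        \<le> real (\<Sum>s\<in>dirs. card {c \<in> H s P. glimpsed \<Gamma> ?r x c})" by (rule of_nat_mono)
      then show ?thesis by (simp only: of_nat_sum)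
    qed
    have "(\<integral>\<^sup>+x. ennreal (real (card {c \<in> P. glimpsed \<Gamma> ?r x c})) * indicator (ball x0 (R / 8)) x \<partial>lborel)
      \<le> (\<integral>\<^sup>+x. (\<Sum>s\<in>dirs. ennreal (real (card {c \<in> H s P. glimpsed \<Gamma> ?r x c})) * indicator (ball x0 (R / 8)) x) \<partial>lborel)"
    proof (rule nn_integral_mono)
      fix x
      have "ennreal (real (card {c \<in> P. glimpsed \<Gamma> ?r x c})) \<le> (\<Sum>s\<in>dirs. ennreal (real (card {c \<in> H s P. glimpsed \<Gamma> ?r x c})))"
        by (subst sum_ennreal) (auto intro: ennreal_leI cards)
      then show "ennreal (real (card {c \<in> P. glimpsed \<Gamma> ?r x c})) * indicator (ball x0 (R / 8)) x
        \<le> (\<Sum>s\<in>dirs. ennreal (real (card {c \<in> H s P. glimpsed \<Gamma> ?r x c})) * indicator (ball x0 (R / 8)) x)"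
        unfolding sum_distrib_right[symmetric] by (intro mult_right_mono) auto
    qed
    also have "\<dots> = (\<Sum>s\<in>dirs. \<integral>\<^sup>+x. ennreal (real (card {c \<in> H s P. glimpsed \<Gamma> ?r x c})) * indicator (ball x0 (R / 8)) x \<partial>lborel)"
    proof (rule nn_integral_sum)
      fix s assume "s \<in> dirs"
      have m: "(\<lambda>x. ennreal (real (card {c \<in> H s P. glimpsed \<Gamma> ?r x c}))) \<in> borel_measurable borel"
        by (rule card_glimpsed_measurable[OF comp]) (use a in \<open>simp add: H_def\<close>)
      show "(\<lambda>x. ennreal (real (card {c \<in> H s P. glimpsed \<Gamma> ?r x c})) * indicator (ball x0 (R / 8)) x) \<in> borel_measurable lborel"
        by (intro borel_measurable_times_ennreal borel_measurable_indicator) (use m in auto)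
    qed
    also have "\<dots> \<le> (\<Sum>s\<in>dirs. ennreal (K s * sqrt (real (card P) * (2^k * (real k + 1)))))"
      by (intro sum_mono KI a)
    also have "\<dots> = ennreal ((\<Sum>s\<in>dirs. K s) * sqrt (real (card P) * (2^k * (real k + 1))))"
      by (subst sum_ennreal) (auto simp: K sum_distrib_right)
    finally show "(\<integral>\<^sup>+x. ennreal (real (card {c \<in> P. glimpsed \<Gamma> ((1/2)^k) x c})) * indicator (ball x0 (R / 8)) x \<partial>lborel)
      \<le> ennreal ((\<Sum>s\<in>dirs. K s) * sqrt (real (card P) * (2^k * (real k + 1))))" .
  qed
qed

section \<open>Covers by balls around grid points\<close>

lemma hausdorff_premeasure_antimono:
  "\<delta> \<le> \<delta>' \<Longrightarrow> hausdorff_premeasure s \<delta>' A \<le> hausdorff_premeasure s \<delta> A"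
  unfolding hausdorff_premeasure_def
  by (rule INF_superset_mono) (auto simp: delta_cover_def, meson order_trans)

text \<open>
  The balls are indexed by pairs (level, position in an enumeration of the level), which are coded
  as natural numbers; unused positions carry the empty set.
\<close>

lemma hausdorff_premeasure_le_balls:
  fixes P :: "nat \<Rightarrow> 'a::euclidean_space set"
  assumes \<tau>: "0 < \<tau>" and fin: "\<And>k. finite (P k)" and small: "\<And>k. k < j \<Longrightarrow> P k = {}"
    and cover: "A \<subseteq> (\<Union>k. \<Union>c\<in>P k. cball c (3 * (1/2)^k))"
  shows "hausdorff_premeasure \<tau> (6 * (1/2)^j) A
    \<le> (\<Sum>k. ennreal (real (card (P k)) * (6 * (1/2)^k) powr \<tau>))"
proof -
  have "\<exists>h. bij_betw h {0..<card (P k)} (P k)" for k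
    using ex_bij_betw_nat_finite[OF fin] .
  then obtain h where h: "\<And>k. bij_betw (h k) {0..<card (P k)} (P k)" by metis
  define V where "V p = (if snd p < card (P (fst p)) then cball (h (fst p) (snd p)) (3 * (1/2)^(fst p)) else {})" for p
  have dV: "diameter (V p) \<le> 6 * (1/2)^j" "bounded (V p)" for p
  proof -
    show "bounded (V p)" by (auto simp: V_def)
    show "diameter (V p) \<le> 6 * (1/2)^j"
    proof (cases "snd p < card (P (fst p))")
      case True
      then have "j \<le> fst p" using small[of "fst p"] by (auto simp: not_less[symmetric])
      then have "(1/2::real)^(fst p) \<le> (1/2)^j" by (intro power_decreasing) auto
      then show ?thesis using True by (simp add: V_def)
    qed (simp add: V_def)
  qed
  have "delta_cover (6 * (1/2)^j) A (\<lambda>m. V (prod_decode m))"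
    unfolding delta_cover_def
  proof (intro conjI allI dV subsetI)
    fix x assume "x \<in> A"
    then obtain k c where c: "c \<in> P k" "x \<in> cball c (3 * (1/2)^k)" using cover by auto
    then have "c \<in> h k ` {0..<card (P k)}" using h[of k] by (simp add: bij_betw_def)
    then obtain i where i: "i < card (P k)" "h k i = c" by auto
    then have "x \<in> V (prod_decode (prod_encode (k, i)))" using c by (simp add: V_def)
    then show "x \<in> (\<Union>m. V (prod_decode m))" by blast
  qed
  then have "hausdorff_premeasure \<tau> (6 * (1/2)^j) A \<le> (\<Sum>m. diam_weight \<tau> (V (prod_decode m)))"
    unfolding hausdorff_premeasure_def by (intro INF_lower) auto
  also have "\<dots> = (\<Sum>k. ennreal (real (card (P k)) * (6 * (1/2)^k) powr \<tau>))"
  proof (rule suminf_ennreal_2dimen)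
    fix k
    have w: "diam_weight \<tau> (V (k, i)) = (if i < card (P k) then ennreal ((6 * (1/2)^k) powr \<tau>) else 0)" for i
      using \<tau> by (auto simp: diam_weight_def V_def)
    have "(\<Sum>i. diam_weight \<tau> (V (k, i))) = (\<Sum>i<card (P k). diam_weight \<tau> (V (k, i)))"
      by (rule suminf_finite) (auto simp: w)
    also have "\<dots> = of_nat (card (P k)) * ennreal ((6 * (1/2)^k) powr \<tau>)" by (simp add: w)
    also have "\<dots> = ennreal (real (card (P k)) * (6 * (1/2)^k) powr \<tau>)"
      by (simp add: ennreal_mult ennreal_of_nat_eq_real_of_nat)
    finally show "ennreal (real (card (P k)) * (6 * (1/2)^k) powr \<tau>) = (\<Sum>i. diam_weight \<tau> (V (k, i)))" ..
  qed
  finally show ?thesis .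
qed

definition grid_point :: "nat \<Rightarrow> real^2 \<Rightarrow> real^2" where
  "grid_point k w = (\<chi> l. (1/2)^k * of_int \<lfloor>w $ l / (1/2)^k\<rfloor>)"

lemma grid_point_in_grid: "grid_point k w \<in> grid k"
  by (simp add: grid_def grid_point_def)

lemma dist_grid_point: "dist w (grid_point k w) \<le> 2 * (1/2)^k"
proof -
  have "\<bar>(w - grid_point k w) $ l\<bar> \<le> (1/2)^k" for l
  proof -
    have "(w - grid_point k w) $ l = (1/2)^k * (w $ l / (1/2)^k - of_int \<lfloor>w $ l / (1/2)^k\<rfloor>)"
      by (simp add: grid_point_def algebra_simps)
    also have "\<bar>\<dots>\<bar> \<le> (1/2)^k * 1"
      unfolding abs_mult
      by (intro mult_mono) (auto simp: abs_le_iff, linarith+)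
    finally show ?thesis by simp
  qed
  then have "(\<Sum>l\<in>UNIV. \<bar>(w - grid_point k w) $ l\<bar>) \<le> (\<Sum>l\<in>(UNIV::2 set). (1/2)^k)"
    by (intro sum_mono)
  then show ?thesis using norm_le_l1_cart[of "w - grid_point k w"] by (simp add: dist_norm)
qed

text \<open>
  A scale \<open>k\<close> for a covering set of diameter \<open>d\<close>. The term with \<open>i\<close> is there for sets of diameter
  \<open>0\<close>, which have no dyadic scale of their own; the \<open>i\<close>-th set of the cover may be enlarged at a
  cost that is summable over \<open>i\<close>.
\<close>

lemma dyadic_scale:
  fixes d \<sigma> :: real
  assumes d: "0 \<le> d" "d \<le> (1/2)^j" and \<sigma>: "0 < \<sigma>"
  shows "\<exists>k\<ge>j. d \<le> (1/2)^k \<and> ((1/2)^k) powr \<sigma> \<le> 2 powr \<sigma> * d powr \<sigma> + ((1/2)^i) powr \<sigma>"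
proof (cases "d \<le> (1/2)^(j + i)")
  case True
  have "(1/2::real)^(j+i) \<le> (1/2)^i" by (intro power_decreasing) auto
  then have "((1/2::real)^(j+i)) powr \<sigma> \<le> ((1/2)^i) powr \<sigma>" using \<sigma> by (intro powr_mono2) auto
  then show ?thesis using True by (intro exI[of _ "j+i"]) (auto intro: add_increasing)
next
  case False
  define m where "m = (LEAST m. (1/2)^m < d)"
  have m: "(1/2)^m < d" unfolding m_def by (rule LeastI[of _ "j+i"]) (use False in simp)
  have "j < m"
  proof (rule ccontr)
    assume "\<not> j < m"
    then have "(1/2::real)^j \<le> (1/2)^m" by (intro power_decreasing) auto
    then show False using m d by linarith
  qed
  then obtain k where k: "m = Suc k" "j \<le> k" by (cases m) auto
  have "d \<le> (1/2)^k" using not_less_Least[of k "\<lambda>m. (1/2)^m < d"] k unfolding m_def by auto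
  moreover have "((1/2)^k) powr \<sigma> \<le> (2 * d) powr \<sigma>"
    using m k \<sigma> by (intro powr_mono2) auto
  then have "((1/2)^k) powr \<sigma> \<le> 2 powr \<sigma> * d powr \<sigma> + ((1/2)^i) powr \<sigma>"
    using d by (simp add: powr_mult add_increasing2)
  ultimately show ?thesis using k by blast
qed

text \<open>
  Each set of a fine cover of small total weight is replaced by one ball around a grid point of
  its dyadic scale. The weights still have a total of at most \<open>T\<close>, so each level \<open>k\<close> contains at
  most \<open>T * 2^(k * \<sigma>)\<close> balls. It is this bound for every single level that makes the Hausdorff
  dimension, and not a box dimension, sufficient.
\<close>

lemma dyadic_cover:
  fixes \<Gamma> :: "(real^2) set"
  assumes \<sigma>: "0 < \<sigma>" and null: "hausdorff_measure \<sigma> \<Gamma> = 0"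
  shows "\<exists>T\<ge>0. \<forall>j. \<exists>P. (\<forall>k. finite (P k) \<and> P k \<subseteq> grid k \<and> real (card (P k)) \<le> T * (2^k) powr \<sigma> \<and> (k < j \<longrightarrow> P k = {}))
     \<and> \<Gamma> \<subseteq> (\<Union>k. \<Union>c\<in>P k. cball c (3 * (1/2)^k))"
proof -
  define q where "q = (1/2::real) powr \<sigma>"
  have q: "0 \<le> q" "q < 1" using \<sigma> powr_less_mono2[of \<sigma> "1/2::real" 1] by (auto simp: q_def)
  have qi: "((1/2)^i) powr \<sigma> = q^i" for i
  proof (induction i)
    case (Suc i)
    have "((1/2::real)^Suc i) powr \<sigma> = (1/2) powr \<sigma> * ((1/2)^i) powr \<sigma>"
      unfolding power_Suc by (rule powr_mult)
    then show ?case using Suc by (simp add: q_def)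
  qed simp
  have sq: "summable (\<lambda>i. q^i)" using q by (intro summable_geometric) auto
  define T where "T = 2 powr \<sigma> + (\<Sum>i. q^i)"
  have T0: "0 \<le> T" using q sq by (simp add: T_def suminf_nonneg)
  show ?thesis
  proof (intro exI[of _ T] conjI T0 allI)
    fix j
    have "hausdorff_premeasure \<sigma> ((1/2)^j) \<Gamma> \<le> hausdorff_measure \<sigma> \<Gamma>"
      unfolding hausdorff_measure_def by (rule SUP_upper) auto
    then have "hausdorff_premeasure \<sigma> ((1/2)^j) \<Gamma> < 1" using null by simp
    then obtain U where U: "delta_cover ((1/2)^j) \<Gamma> U" and sm: "(\<Sum>i. diam_weight \<sigma> (U i)) < 1"
      unfolding hausdorff_premeasure_def INF_less_iff by auto
    have dU: "bounded (U i)" "diameter (U i) \<le> (1/2)^j" "0 \<le> diameter (U i)" for i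
      using U by (auto simp: delta_cover_def diameter_ge_0)
    have "\<exists>k\<ge>j. diameter (U i) \<le> (1/2)^k \<and> ((1/2)^k) powr \<sigma> \<le> 2 powr \<sigma> * diameter (U i) powr \<sigma> + ((1/2)^i) powr \<sigma>" for i
      using dyadic_scale[OF dU(3,2) \<sigma>] .
    then obtain kk where kk: "\<And>i. j \<le> kk i" "\<And>i. diameter (U i) \<le> (1/2)^(kk i)"
      "\<And>i. ((1/2)^(kk i)) powr \<sigma> \<le> 2 powr \<sigma> * diameter (U i) powr \<sigma> + ((1/2)^i) powr \<sigma>" by metis
    define I where "I k = {i. kk i = k \<and> U i \<inter> \<Gamma> \<noteq> {}}" for k
    define w where "w i = (SOME x. x \<in> U i \<inter> \<Gamma>)" for i
    have w: "w i \<in> U i" if "U i \<inter> \<Gamma> \<noteq> {}" for i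
      unfolding w_def using that some_in_eq[of "U i \<inter> \<Gamma>"] by auto
    have bound: "real (card F) \<le> T * (2^k) powr \<sigma>" if F: "finite F" "F \<subseteq> I k" for F k
    proof -
      have "ennreal (\<Sum>i\<in>F. diameter (U i) powr \<sigma>) = (\<Sum>i\<in>F. ennreal (diameter (U i) powr \<sigma>))"
        by (rule sum_ennreal[symmetric]) simp
      also have "\<dots> = (\<Sum>i\<in>F. diam_weight \<sigma> (U i))"
        using F \<sigma> by (intro sum.cong refl) (auto simp: I_def diam_weight_def)
      also have "\<dots> \<le> (\<Sum>i. diam_weight \<sigma> (U i))" by (rule sum_le_suminf) (use F in auto)
      also have "\<dots> < 1" by (rule sm)
      finally have s1: "(\<Sum>i\<in>F. diameter (U i) powr \<sigma>) \<le> 1"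
        by (simp add: ennreal_less_one_iff sum_nonneg)
      have "real (card F) * ((1/2)^k) powr \<sigma> = (\<Sum>i\<in>F. ((1/2)^(kk i)) powr \<sigma>)"
        using F by (subst sum.cong[OF refl, of F _ "\<lambda>i. ((1/2)^k) powr \<sigma>"]) (auto simp: I_def)
      also have "\<dots> \<le> (\<Sum>i\<in>F. 2 powr \<sigma> * diameter (U i) powr \<sigma> + q^i)"
        using kk(3) by (intro sum_mono) (simp add: qi)
      also have "\<dots> = 2 powr \<sigma> * (\<Sum>i\<in>F. diameter (U i) powr \<sigma>) + (\<Sum>i\<in>F. q^i)"
        by (simp add: sum.distrib sum_distrib_left)
      also have "\<dots> \<le> 2 powr \<sigma> * 1 + (\<Sum>i. q^i)"
        using s1 sq F q by (intro add_mono mult_left_mono sum_le_suminf) auto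
      finally have "real (card F) * ((1/2)^k) powr \<sigma> \<le> T" by (simp add: T_def)
      then have "real (card F) * ((1/2)^k) powr \<sigma> * (2^k) powr \<sigma> \<le> T * (2^k) powr \<sigma>"
        by (intro mult_right_mono) auto
      moreover have "((1/2)^k) powr \<sigma> * (2^k) powr \<sigma> = (1::real)"
        by (subst powr_mult[symmetric]) (auto simp flip: power_mult_distrib)
      ultimately show ?thesis by (simp add: mult.assoc)
    qed
    have finI: "finite (I k)" for k
    proof (rule finite_if_finite_subsets_card_bdd[THEN conjunct1])
      show "card F \<le> nat \<lfloor>T * (2^k) powr \<sigma>\<rfloor>" if "F \<subseteq> I k" "finite F" for F
        using bound[OF that(2,1)] by (simp add: le_nat_floor)
    qed
    define P where "P k = (\<lambda>i. grid_point k (w i)) ` I k" for k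
    show "\<exists>P. (\<forall>k. finite (P k) \<and> P k \<subseteq> grid k \<and> real (card (P k)) \<le> T * (2^k) powr \<sigma> \<and> (k < j \<longrightarrow> P k = {}))
     \<and> \<Gamma> \<subseteq> (\<Union>k. \<Union>c\<in>P k. cball c (3 * (1/2)^k))"
    proof (intro exI[of _ P] conjI allI impI)
      fix k
      show "finite (P k)" using finI by (simp add: P_def)
      show "P k \<subseteq> grid k" using grid_point_in_grid by (auto simp: P_def)
      have "card (P k) \<le> card (I k)" unfolding P_def using finI by (rule card_image_le)
      then show "real (card (P k)) \<le> T * (2^k) powr \<sigma>" using bound[OF finI[of k] order_refl] by linarith
      show "P k = {}" if "k < j" using kk(1) that by (auto simp: P_def I_def) (metis not_less)
    next
      show "\<Gamma> \<subseteq> (\<Union>k. \<Union>c\<in>P k. cball c (3 * (1/2)^k))"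
      proof
        fix x assume x: "x \<in> \<Gamma>"
        then obtain i where i: "x \<in> U i" using U by (auto simp: delta_cover_def)
        then have ne: "U i \<inter> \<Gamma> \<noteq> {}" using x by auto
        define c where "c = grid_point (kk i) (w i)"
        have "c \<in> P (kk i)" using ne by (auto simp: P_def I_def c_def)
        have "dist (w i) x \<le> (1/2)^(kk i)"
          using diameter_bounded_bound[OF dU(1) w[OF ne] i] kk(2)[of i] by linarith
        then have "dist c x \<le> 3 * (1/2)^(kk i)"
          using dist_triangle[of c x "w i"] dist_grid_point[of "w i" "kk i"]
          by (simp add: c_def dist_commute)
        then show "x \<in> (\<Union>k. \<Union>c\<in>P k. cball c (3 * (1/2)^k))"
          using \<open>c \<in> P (kk i)\<close> by auto
      qed
    qed
  qed
qed

text \<open>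
  A bounded plane set is covered by \<open>O(4^k)\<close> balls of radius about \<open>2^(-k)\<close>. The exponent \<open>3\<close> is
  chosen because it is the larger zero of \<open>(s - 1) * (s - 3)\<close>.
\<close>

lemma hausdorff_measure_3_bounded:
  fixes A :: "(real^2) set"
  assumes "bounded A"
  shows "hausdorff_measure 3 A = 0"
proof -
  obtain D0 where D0: "\<And>x. x \<in> A \<Longrightarrow> norm x \<le> D0" using assms by (auto simp: bounded_iff)
  define D where "D = nat \<lceil>D0\<rceil>"
  have D: "norm x \<le> real D" if "x \<in> A" for x
    using D0[OF that] unfolding D_def by linarith
  have bound: "hausdorff_premeasure 3 (6 * (1/2)^k) A \<le> ennreal (216 * (2 * real D + 3)\<^sup>2 * (1/2)^k)" for k
  proof -
    define m :: int where "m = (int D + 1) * 2^k"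
    define Q where "Q = grid_point k ` A"
    have sub: "Q \<subseteq> (\<lambda>p. \<chi> l. (1/2)^k * of_int (if l = 1 then fst p else snd p)) ` ({-m..m} \<times> {-m..m})"
    proof
      fix c assume "c \<in> Q"
      then obtain x where x: "x \<in> A" "c = grid_point k x" by (auto simp: Q_def)
      have "\<lfloor>x $ l / (1/2)^k\<rfloor> \<in> {-m..m}" for l
      proof -
        have "\<bar>x $ l\<bar> \<le> real D" using component_le_norm_cart[of x l] D[OF x(1)] by linarith
        then have "\<bar>x $ l / (1/2)^k\<bar> \<le> real D * 2^k"
          by (simp add: power_divide abs_mult)
        moreover have "real_of_int m = real D * 2^k + 2^k" by (simp add: m_def algebra_simps)
        moreover have "(1::real) \<le> 2^k" by simp
        ultimately have "- real_of_int m \<le> x $ l / (1/2)^k - 1" "x $ l / (1/2)^k \<le> real_of_int m" by linarith+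
        then show ?thesis by (auto simp: le_floor_iff floor_le_iff)
      qed
      moreover have "c = (\<chi> l. (1/2)^k * of_int (if l = 1 then fst (\<lfloor>x $ 1 / (1/2)^k\<rfloor>, \<lfloor>x $ 2 / (1/2)^k\<rfloor>) else snd (\<lfloor>x $ 1 / (1/2)^k\<rfloor>, \<lfloor>x $ 2 / (1/2)^k\<rfloor>)))"
        unfolding x grid_point_def vec_eq_iff forall_2 by simp
      ultimately show "c \<in> (\<lambda>p. \<chi> l. (1/2)^k * of_int (if l = 1 then fst p else snd p)) ` ({-m..m} \<times> {-m..m})"
        by (intro image_eqI[of _ _ "(\<lfloor>x $ 1 / (1/2)^k\<rfloor>, \<lfloor>x $ 2 / (1/2)^k\<rfloor>)"]) auto
    qed
    have finQ: "finite Q" by (rule finite_subset[OF sub]) auto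
    have m0: "0 \<le> m" by (simp add: m_def)
    have p4: "(4::real)^k = 2^k * 2^k" by (simp flip: power_mult_distrib)
    have "card Q \<le> card ({-m..m} \<times> {-m..m})"
      by (rule order_trans[OF card_mono[OF _ sub] card_image_le]) auto
    also have "\<dots> = nat (2 * m + 1) * nat (2 * m + 1)" by (simp add: card_cartesian_product)
    finally have "real (card Q) \<le> real (nat (2 * m + 1)) * real (nat (2 * m + 1))"
      by (metis of_nat_le_iff of_nat_mult)
    also have "\<dots> \<le> ((2 * real D + 3) * 2^k) * ((2 * real D + 3) * 2^k)"
    proof -
      have "real (nat (2 * m + 1)) = 2 * (real D + 1) * 2^k + 1" using m0 by (simp add: m_def of_nat_nat)
      also have "\<dots> \<le> (2 * real D + 3) * 2^k" by (simp add: algebra_simps)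
      finally show ?thesis by (intro mult_mono) auto
    qed
    finally have cQ: "real (card Q) \<le> (2 * real D + 3)\<^sup>2 * 4^k"
      unfolding power2_eq_square p4 by (simp only: mult_ac)
    define P where "P k' = (if k' = k then Q else {})" for k'
    have "hausdorff_premeasure 3 (6 * (1/2)^k) A \<le> (\<Sum>k'. ennreal (real (card (P k')) * (6 * (1/2)^k') powr 3))"
    proof (rule hausdorff_premeasure_le_balls)
      show "A \<subseteq> (\<Union>k. \<Union>c\<in>P k. cball c (3 * (1/2)^k))"
      proof
        fix x assume "x \<in> A"
        moreover have "x \<in> cball (grid_point k x) (3 * (1/2)^k)"
          by (simp add: dist_commute order_trans[OF dist_grid_point])
        ultimately show "x \<in> (\<Union>k. \<Union>c\<in>P k. cball c (3 * (1/2)^k))"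
          by (auto simp: P_def Q_def intro!: exI[of _ k])
      qed
    qed (use finQ in \<open>auto simp: P_def\<close>)
    also have "\<dots> = (\<Sum>k'\<in>{k}. ennreal (real (card (P k')) * (6 * (1/2)^k') powr 3))"
      by (rule suminf_finite) (auto simp: P_def)
    also have "\<dots> = ennreal (real (card Q) * (6 * (1/2)^k) powr 3)" by (simp add: P_def)
    also have "\<dots> \<le> ennreal (216 * (2 * real D + 3)\<^sup>2 * (1/2)^k)"
    proof (rule ennreal_leI)
      have p3: "(6 * (1/2::real)^k) powr 3 = 216 * (1/8)^k"
      proof -
        have "(6 * (1/2::real)^k) powr 3 = (6 * (1/2)^k)^3"
          using powr_realpow[of "6 * (1/2::real)^k" 3] by simp
        also have "\<dots> = 216 * (1/8)^k" by (simp add: power_mult_distrib power3_eq_cube flip: power_mult_distrib)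
        finally show ?thesis .
      qed
      have "real (card Q) * (6 * (1/2)^k) powr 3 \<le> ((2 * real D + 3)\<^sup>2 * 4^k) * (216 * (1/8)^k)"
        unfolding p3 by (intro mult_right_mono cQ) auto
      also have "\<dots> = 216 * (2 * real D + 3)\<^sup>2 * (4^k * (1/8)^k)" by simp
      also have "4^k * (1/8)^k = (1/2::real)^k" by (simp flip: power_mult_distrib)
      finally show "real (card Q) * (6 * (1/2)^k) powr 3 \<le> 216 * (2 * real D + 3)\<^sup>2 * (1/2)^k" .
    qed
    finally show ?thesis .
  qed
  have lim: "(\<lambda>k. ennreal (c * (1/2)^k)) \<longlonglongrightarrow> 0" for c :: real
  proof -
    have "(\<lambda>k. c * (1/2)^k) \<longlonglongrightarrow> c * 0"
      by (intro tendsto_mult tendsto_const LIMSEQ_power_zero) auto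
    then show ?thesis using tendsto_ennrealI by fastforce
  qed
  have "hausdorff_premeasure 3 \<delta> A = 0" if \<delta>: "0 < \<delta>" for \<delta>
  proof -
    have "(\<lambda>k. 6 * (1/2::real)^k) \<longlonglongrightarrow> 6 * 0"
      by (intro tendsto_mult tendsto_const LIMSEQ_power_zero) auto
    then have "\<forall>\<^sub>F k in sequentially. 6 * (1/2::real)^k < \<delta>" using \<delta> by (intro order_tendstoD(2)) auto
    then have "\<forall>\<^sub>F k in sequentially. hausdorff_premeasure 3 \<delta> A \<le> ennreal (216 * (2 * real D + 3)\<^sup>2 * (1/2)^k)"
      by eventually_elim (meson bound hausdorff_premeasure_antimono less_imp_le order_trans)
    then have "hausdorff_premeasure 3 \<delta> A \<le> 0"
      by (intro tendsto_lowerbound[OF lim]) auto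
    then show ?thesis by simp
  qed
  then show ?thesis unfolding hausdorff_measure_def by (intro antisym SUP_least) auto
qed

section \<open>Dimension of the visible part\<close>

lemma visible_part_of_member:
  assumes "x \<in> \<Gamma>"
  shows "visible_part \<Gamma> x = {x}"
proof (intro set_eqI iffI)
  fix u assume "u \<in> visible_part \<Gamma> x"
  then have eq: "closed_segment x u \<inter> \<Gamma> = {u}" by (simp add: visible_part_def)
  have "x \<in> closed_segment x u \<inter> \<Gamma>" using assms by simp
  then show "u \<in> {x}" by (simp add: eq)
qed (use assms in \<open>simp add: visible_part_def\<close>)

text \<open>
  The left side bounds the average contribution of level \<open>k\<close> to the \<open>\<tau>\<close>-dimensional measure.
  Replacing \<open>sqrt (k + 1)\<close> by \<open>k + 1\<close> makes the right side a term of the derivative of a geometric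
  series.
\<close>

lemma scale_exponents:
  fixes K T \<sigma> \<tau> :: real
  assumes T: "0 \<le> T" and K: "0 \<le> K" and c: "real N \<le> T * (2^k) powr \<sigma>"
  shows "K * sqrt (real N * (2^k * (real k + 1))) * (6 * (1/2)^k) powr \<tau>
    \<le> K * sqrt T * 6 powr \<tau> * (real (Suc k) * (2 powr ((\<sigma> + 1) / 2 - \<tau>))^k)"
proof -
  have pk: "(2::real)^k = 2 powr (real k)" by (simp add: powr_realpow)
  have pw: "(6 * (1/2::real)^k) powr \<tau> = 6 powr \<tau> * (2^k) powr (- \<tau>)"
  proof -
    have "(1/2::real)^k = inverse (2^k)" by (simp add: power_one_over inverse_eq_divide)
    then have "((1/2::real)^k) powr \<tau> = (2^k) powr (- \<tau>)"
      by (simp only: powr_minus inverse_powr zero_le_power zero_le_numeral)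
    then show ?thesis by (simp only: powr_mult)
  qed
  have "real N * (2^k * (real k + 1)) \<le> (T * (2^k) powr \<sigma>) * (2^k * (real (Suc k))\<^sup>2)"
  proof (intro mult_mono c)
    show "real k + 1 \<le> (real (Suc k))\<^sup>2" by (simp add: power2_eq_square algebra_simps)
  qed (use T in auto)
  also have "\<dots> = T * (real (Suc k) * (2^k) powr ((\<sigma> + 1) / 2))\<^sup>2"
  proof -
    have "((2^k) powr ((\<sigma> + 1) / 2))\<^sup>2 = ((2::real)^k) powr (\<sigma> + 1)"
      by (simp add: power2_eq_square flip: powr_add)
    also have "\<dots> = (2^k) powr \<sigma> * 2^k" by (simp add: powr_add)
    finally show ?thesis by (simp add: power_mult_distrib)
  qed
  finally have "sqrt (real N * (2^k * (real k + 1))) \<le> sqrt (T * (real (Suc k) * (2^k) powr ((\<sigma> + 1) / 2))\<^sup>2)"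
    by (rule real_sqrt_le_mono)
  also have "\<dots> = sqrt T * (real (Suc k) * (2^k) powr ((\<sigma> + 1) / 2))"
    by (simp add: real_sqrt_mult)
  finally have "K * sqrt (real N * (2^k * (real k + 1))) * (6 powr \<tau> * (2^k) powr (- \<tau>))
      \<le> K * (sqrt T * (real (Suc k) * (2^k) powr ((\<sigma> + 1) / 2))) * (6 powr \<tau> * (2^k) powr (- \<tau>))"
    using K by (intro mult_right_mono mult_left_mono) auto
  also have "K * (sqrt T * (real (Suc k) * (2^k) powr ((\<sigma> + 1) / 2))) * (6 powr \<tau> * (2^k) powr (- \<tau>))
      = K * sqrt T * 6 powr \<tau> * (real (Suc k) * ((2^k) powr ((\<sigma> + 1) / 2) * (2^k) powr (- \<tau>)))" by simp
  also have "(2^k) powr ((\<sigma> + 1) / 2) * (2^k) powr (- \<tau>) = (2 powr ((\<sigma> + 1) / 2 - \<tau>))^k"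
    unfolding pk powr_powr by (simp add: powr_realpow[symmetric] powr_powr powr_add[symmetric] algebra_simps)
  finally show ?thesis unfolding pw .
qed

text \<open>
  \<open>F j x\<close> is the weight of those balls of the \<open>j\<close>-th cover that are seen from \<open>x\<close>. It dominates
  the premeasure of the visible part, and its integral is at most the tail from \<open>j\<close> on of a
  convergent series. By the lemma of Fatou \<open>liminf F j\<close> vanishes almost everywhere.
\<close>

lemma AE_local_null_visible_part:
  fixes \<Gamma> :: "(real^2) set"
  assumes comp: "compact \<Gamma>" and conn: "connected \<Gamma>" and R: "0 < R" and disj: "ball x0 R \<inter> \<Gamma> = {}"
    and \<sigma>: "0 < \<sigma>" and null: "hausdorff_measure \<sigma> \<Gamma> = 0" and \<tau>: "(\<sigma> + 1) / 2 < \<tau>"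
  shows "AE x in lborel. x \<in> ball x0 (R / 8) \<longrightarrow> hausdorff_measure \<tau> (visible_part \<Gamma> x) = 0"
proof -
  let ?B = "ball x0 (R / 8)"
  have \<tau>0: "0 < \<tau>" using \<sigma> \<tau> by simp
  obtain K where K: "0 \<le> K" and KI: "\<And>k P. 3 * (1/2)^k \<le> R / 8 \<Longrightarrow> finite P \<Longrightarrow> P \<subseteq> grid k \<Longrightarrow>
    (\<integral>\<^sup>+x. ennreal (real (card {c \<in> P. glimpsed \<Gamma> ((1/2)^k) x c})) * indicator ?B x \<partial>lborel)
      \<le> ennreal (K * sqrt (real (card P) * (2^k * (real k + 1))))"
    using nn_integral_card_glimpsed[OF comp conn R disj] by blast
  obtain T where T: "0 \<le> T" and cov: "\<forall>j. \<exists>P. (\<forall>k. finite (P k) \<and> P k \<subseteq> grid k \<and> real (card (P k)) \<le> T * (2^k) powr \<sigma> \<and> (k < j \<longrightarrow> P k = {}))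
     \<and> \<Gamma> \<subseteq> (\<Union>k. \<Union>c\<in>P k. cball c (3 * (1/2)^k))"
    using dyadic_cover[OF \<sigma> null] by blast
  from choice[OF cov] obtain P where PP: "\<forall>j. (\<forall>k. finite (P j k) \<and> P j k \<subseteq> grid k \<and>
        real (card (P j k)) \<le> T * (2^k) powr \<sigma> \<and> (k < j \<longrightarrow> P j k = {}))
     \<and> \<Gamma> \<subseteq> (\<Union>k. \<Union>c\<in>P j k. cball c (3 * (1/2)^k))" ..
  have P: "\<And>j k. finite (P j k)" "\<And>j k. P j k \<subseteq> grid k" "\<And>j k. real (card (P j k)) \<le> T * (2^k) powr \<sigma>"
      "\<And>j k. k < j \<Longrightarrow> P j k = {}"
    and Pcov: "\<And>j. \<Gamma> \<subseteq> (\<Union>k. \<Union>c\<in>P j k. cball c (3 * (1/2)^k))" using PP by simp_all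
  define N where "N j k x = real (card {c \<in> P j k. glimpsed \<Gamma> ((1/2)^k) x c})" for j k x
  define F where "F j x = (\<Sum>k. ennreal (N j k x * (6 * (1/2)^k) powr \<tau>)) * indicator ?B x" for j x
  have N0: "0 \<le> N j k x" for j k x by (simp add: N_def)
  have Nm: "(\<lambda>x. ennreal (N j k x)) \<in> borel_measurable borel" for j k
    unfolding N_def by (rule card_glimpsed_measurable[OF comp P(1)])
  have Bm: "?B \<in> sets borel" by (rule borel_open) simp
  have Fe: "F j x = (\<Sum>k. ennreal ((6 * (1/2)^k) powr \<tau>) * (ennreal (N j k x) * indicator ?B x))" for j x
    unfolding F_def ennreal_suminf_multc[symmetric]
    by (intro suminf_cong) (simp add: ennreal_mult N0 mult_ac)
  have tm: "(\<lambda>x. ennreal ((6 * (1/2)^k) powr \<tau>) * (ennreal (N j k x) * indicator ?B x)) \<in> borel_measurable lborel" for j k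
    by (intro borel_measurable_times_ennreal borel_measurable_indicator borel_measurable_const)
      (use Nm Bm in auto)
  have Fm: "F j \<in> borel_measurable lborel" for j
    unfolding Fe[abs_def] by (intro borel_measurable_suminf_order tm)
  have pre: "hausdorff_premeasure \<tau> (6 * (1/2)^j) (visible_part \<Gamma> x) \<le> F j x" if "x \<in> ?B" for j x
  proof -
    have "hausdorff_premeasure \<tau> (6 * (1/2)^j) (visible_part \<Gamma> x)
      \<le> (\<Sum>k. ennreal (real (card {c \<in> P j k. glimpsed \<Gamma> ((1/2)^k) x c}) * (6 * (1/2)^k) powr \<tau>))"
    proof (rule hausdorff_premeasure_le_balls[OF \<tau>0])
      show "visible_part \<Gamma> x \<subseteq> (\<Union>k. \<Union>c\<in>{c \<in> P j k. glimpsed \<Gamma> ((1/2)^k) x c}. cball c (3 * (1/2)^k))"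
      proof
        fix u assume u: "u \<in> visible_part \<Gamma> x"
        then have "u \<in> \<Gamma>" by (simp add: visible_part_def)
        then obtain k c where c: "c \<in> P j k" "u \<in> cball c (3 * (1/2)^k)" using Pcov[of j] by blast
        then have "glimpsed \<Gamma> ((1/2)^k) x c"
          using visible_part_nearly_visible[OF u, of "(1/2)^k"] by (auto simp: glimpsed_def dist_commute)
        then show "u \<in> (\<Union>k. \<Union>c\<in>{c \<in> P j k. glimpsed \<Gamma> ((1/2)^k) x c}. cball c (3 * (1/2)^k))"
          using c by blast
      qed
    qed (use P in auto)
    then show ?thesis using that by (simp add: F_def N_def)
  qed
  define q where "q = 2 powr ((\<sigma> + 1) / 2 - \<tau>)"
  have q: "0 \<le> q" "q < 1" using \<tau> powr_less_mono[of "(\<sigma> + 1) / 2 - \<tau>" 0 2] by (auto simp: q_def)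
  define a where "a k = K * sqrt T * 6 powr \<tau> * (real (Suc k) * q^k)" for k
  have a0: "0 \<le> a k" for k using K T q by (simp add: a_def)
  have "summable (\<lambda>k. real (Suc k) * q^k)"
    using geometric_deriv_sums[of q] q by (auto intro: sums_summable)
  then have sa: "summable a" unfolding a_def by (rule summable_mult)
  define tail where "tail j = (\<Sum>k. a (k + j))" for j
  have sat: "summable (\<lambda>k. a (k + j))" for j using sa by (rule summable_ignore_initial_segment)
  have tail0: "tail \<longlonglongrightarrow> 0"
  proof -
    have "tail = (\<lambda>j. suminf a - (\<Sum>k<j. a k))"
      unfolding tail_def using suminf_minus_initial_segment[OF sa] by (intro ext) simp
    moreover have "(\<lambda>j. suminf a - (\<Sum>k<j. a k)) \<longlonglongrightarrow> suminf a - suminf a"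
      by (intro tendsto_diff tendsto_const summable_LIMSEQ sa)
    ultimately show ?thesis by simp
  qed
  have intF: "(\<integral>\<^sup>+x. F j x \<partial>lborel) \<le> ennreal (tail j)" if j: "3 * (1/2)^j \<le> R / 8" for j
  proof -
    have "(\<integral>\<^sup>+x. F j x \<partial>lborel)
      = (\<Sum>k. \<integral>\<^sup>+x. ennreal ((6 * (1/2)^k) powr \<tau>) * (ennreal (N j k x) * indicator ?B x) \<partial>lborel)"
      unfolding Fe by (rule nn_integral_suminf) (rule tm)
    also have "\<dots> = (\<Sum>k. ennreal ((6 * (1/2)^k) powr \<tau>) * (\<integral>\<^sup>+x. ennreal (N j k x) * indicator ?B x \<partial>lborel))"
      by (intro suminf_cong nn_integral_cmult borel_measurable_times_ennreal borel_measurable_indicator)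
        (use Nm Bm in auto)
    also have "\<dots> \<le> (\<Sum>k. ennreal (if k < j then 0 else a k))"
    proof (intro suminf_le summableI)
      fix k
      show "ennreal ((6 * (1/2)^k) powr \<tau>) * (\<integral>\<^sup>+x. ennreal (N j k x) * indicator ?B x \<partial>lborel)
        \<le> ennreal (if k < j then 0 else a k)"
      proof (cases "k < j")
        case True
        then show ?thesis using P(4) by (simp add: N_def)
      next
        case False
        then have "(1/2::real)^k \<le> (1/2)^j" by (intro power_decreasing) auto
        then have k: "3 * (1/2)^k \<le> R / 8" using j by linarith
        have "ennreal ((6 * (1/2)^k) powr \<tau>) * (\<integral>\<^sup>+x. ennreal (N j k x) * indicator ?B x \<partial>lborel)
          \<le> ennreal ((6 * (1/2)^k) powr \<tau>) * ennreal (K * sqrt (real (card (P j k)) * (2^k * (real k + 1))))"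
          unfolding N_def by (intro mult_left_mono KI k P) auto
        also have "\<dots> = ennreal (K * sqrt (real (card (P j k)) * (2^k * (real k + 1))) * (6 * (1/2)^k) powr \<tau>)"
          using K by (subst ennreal_mult[symmetric]) (auto simp: mult.commute)
        also have "\<dots> \<le> ennreal (a k)"
          unfolding a_def q_def by (intro ennreal_leI scale_exponents T K P)
        finally show ?thesis using False by simp
      qed
    qed
    also have "\<dots> = ennreal (tail j)"
    proof -
      have sm: "summable (\<lambda>k. if k < j then 0 else a k)"
        using sat[of j] summable_iff_shift[of "\<lambda>k. if k < j then 0 else a k" j] by simp
      have "(\<Sum>k. ennreal (if k < j then 0 else a k)) = ennreal (\<Sum>k. if k < j then 0 else a k)"
        by (rule suminf_ennreal2) (use a0 sm in auto)
      also have "(\<Sum>k. if k < j then 0 else a k) = tail j"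
        using suminf_split_initial_segment[OF sm, of j] by (simp add: tail_def)
      finally show ?thesis .
    qed
    finally show ?thesis .
  qed
  have half0: "(\<lambda>j. c * (1/2::real)^j) \<longlonglongrightarrow> 0" for c
    using tendsto_mult[OF tendsto_const[of c] LIMSEQ_power_zero[of "1/2::real"]] by simp
  have "\<forall>\<^sub>F j in sequentially. 3 * (1/2::real)^j < R / 8"
    using R by (intro order_tendstoD(2)[OF half0]) auto
  then have ev: "\<forall>\<^sub>F j in sequentially. (\<integral>\<^sup>+x. F j x \<partial>lborel) \<le> ennreal (tail j)"
    by eventually_elim (intro intF less_imp_le)
  have "(\<integral>\<^sup>+x. liminf (\<lambda>j. F j x) \<partial>lborel) \<le> liminf (\<lambda>j. \<integral>\<^sup>+x. F j x \<partial>lborel)"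
    by (rule nn_integral_liminf) (rule Fm)
  also have "\<dots> \<le> liminf (\<lambda>j. ennreal (tail j))" by (rule Liminf_mono) (rule ev)
  also have "\<dots> = 0"
    using tendsto_ennrealI[OF tail0] by (intro lim_imp_Liminf) auto
  finally have "(\<integral>\<^sup>+x. liminf (\<lambda>j. F j x) \<partial>lborel) = 0" by simp
  moreover have "(\<lambda>x. liminf (\<lambda>j. F j x)) \<in> borel_measurable lborel"
    by (intro borel_measurable_liminf Fm)
  ultimately have "AE x in lborel. liminf (\<lambda>j. F j x) = 0"
    by (simp add: nn_integral_0_iff_AE)
  then show ?thesis
  proof (rule AE_mp, intro AE_I2 impI)
    fix x assume z: "liminf (\<lambda>j. F j x) = 0" and x: "x \<in> ?B"
    have "hausdorff_premeasure \<tau> \<delta> (visible_part \<Gamma> x) = 0" if \<delta>: "0 < \<delta>" for \<delta>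
    proof -
      have "\<forall>\<^sub>F j in sequentially. 6 * (1/2::real)^j < \<delta>"
        using \<delta> by (intro order_tendstoD(2)[OF half0]) auto
      then have "\<forall>\<^sub>F j in sequentially. hausdorff_premeasure \<tau> \<delta> (visible_part \<Gamma> x) \<le> F j x"
        by eventually_elim (meson pre[OF x] hausdorff_premeasure_antimono less_imp_le order_trans)
      then have "hausdorff_premeasure \<tau> \<delta> (visible_part \<Gamma> x) \<le> liminf (\<lambda>j. F j x)"
        by (rule Liminf_bounded)
      then show ?thesis using z by simp
    qed
    then show "hausdorff_measure \<tau> (visible_part \<Gamma> x) = 0"
      unfolding hausdorff_measure_def by (intro antisym SUP_least) auto
  qed
qed

lemma hausdorff_dim_le:
  assumes "0 \<le> s" "hausdorff_measure s A = 0"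
  shows "hausdorff_dim A \<le> s"
  unfolding hausdorff_dim_def
  by (rule cInf_lower) (use assms in \<open>auto intro: bdd_belowI[of _ 0]\<close>)

lemma hausdorff_measure_singleton:
  assumes "0 < s"
  shows "hausdorff_measure s {x} = 0"
proof -
  have "hausdorff_premeasure s \<delta> {x} = 0" if "0 < \<delta>" for \<delta>
  proof -
    have "delta_cover \<delta> {x} (\<lambda>_. {x})" using that by (auto simp: delta_cover_def)
    then have "hausdorff_premeasure s \<delta> {x} \<le> (\<Sum>i::nat. diam_weight s {x})"
      unfolding hausdorff_premeasure_def by (intro INF_lower) auto
    then show ?thesis using assms by (simp add: diam_weight_def)
  qed
  then show ?thesis unfolding hausdorff_measure_def by (intro antisym SUP_least) auto
qed

lemma half_dim_le_bound:
  fixes s :: real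
  assumes "1 \<le> s" "s \<le> 3"
  shows "(s + 1) / 2 \<le> 1 / 2 + sqrt (s - 3 / 4)"
proof -
  have "(s - 1) * (s - 3) \<le> 0" using assms by (intro mult_nonneg_nonpos) auto
  then have "(s / 2)\<^sup>2 \<le> s - 3 / 4" by (simp add: power2_eq_square algebra_simps)
  then have "s / 2 \<le> sqrt (s - 3 / 4)" by (rule real_le_rsqrt)
  then show ?thesis by (simp add: field_simps)
qed

text \<open>
  A property that holds almost everywhere in a neighbourhood of each point of the exceptional set
  holds almost everywhere. For \<open>x \<in> \<Gamma>\<close> the visible part is \<open>{x}\<close>, so only observers with a ball
  disjoint from \<open>\<Gamma>\<close> remain, and there the local lemma applies with exponents tending to
  \<open>(s + 1) / 2\<close>.
\<close>

theorem AE_dim_visible_part_le_half: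
  fixes \<Gamma> :: "(real ^ 2) set"
  assumes comp: "compact \<Gamma>" and conn: "connected \<Gamma>" and dim: "hausdorff_dim \<Gamma> > 1"
  shows "AE x in lebesgue. hausdorff_dim (visible_part \<Gamma> x) \<le> (hausdorff_dim \<Gamma> + 1) / 2"
proof -
  define s where "s = hausdorff_dim \<Gamma>"
  define bad where "bad = {x. \<not> hausdorff_dim (visible_part \<Gamma> x) \<le> (s + 1) / 2}"
  have s: "1 < s" using dim by (simp add: s_def)
  let ?S = "{t. 0 \<le> t \<and> hausdorff_measure t \<Gamma> = 0}"
  have "\<exists>\<sigma>. 0 < \<sigma> \<and> \<sigma> < s + 1 / real (Suc m) \<and> hausdorff_measure \<sigma> \<Gamma> = 0" for m
  proof -
    have ne: "?S \<noteq> {}"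
      using hausdorff_measure_3_bounded[OF compact_imp_bounded[OF comp]] by (auto intro!: exI[of _ 3])
    have "Inf ?S < s + 1 / real (Suc m)" unfolding s_def hausdorff_dim_def by simp
    then obtain \<sigma> where "\<sigma> \<in> ?S" "\<sigma> < s + 1 / real (Suc m)"
      using cInf_lessD[OF ne] by blast
    moreover have "s \<le> \<sigma>" using hausdorff_dim_le[of \<sigma> \<Gamma>] \<open>\<sigma> \<in> ?S\<close> by (simp add: s_def)
    ultimately show ?thesis using s by (intro exI[of _ \<sigma>]) auto
  qed
  then obtain \<sigma> where \<sigma>: "\<And>m. 0 < \<sigma> m" "\<And>m. \<sigma> m < s + 1 / real (Suc m)" "\<And>m. hausdorff_measure (\<sigma> m) \<Gamma> = 0"
    by metis
  \<comment> \<open>This exceeds (\<sigma> m + 1) / 2, which is below (s + 1) / 2 + 1 / (2 * Suc m).\<close>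
  define \<tau> where "\<tau> m = (s + 1) / 2 + 1 / real (Suc m)" for m
  have \<tau>: "(\<sigma> m + 1) / 2 < \<tau> m" "0 \<le> \<tau> m" for m
  proof -
    define e where "e = 1 / real (Suc m)"
    have "0 < e" "\<sigma> m < s + e" using \<sigma>(2)[of m] by (simp_all add: e_def)
    then show "(\<sigma> m + 1) / 2 < \<tau> m" "0 \<le> \<tau> m"
      using s unfolding \<tau>_def e_def[symmetric] by argo+
  qed
  have good: "x \<notin> bad" if "\<And>m. hausdorff_measure (\<tau> m) (visible_part \<Gamma> x) = 0" for x
  proof -
    have "(\<lambda>m. (s + 1) / 2 + 1 / real (Suc m)) \<longlonglongrightarrow> (s + 1) / 2 + 0"
      by (intro tendsto_add tendsto_const LIMSEQ_Suc lim_1_over_n)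
    then have "hausdorff_dim (visible_part \<Gamma> x) \<le> (s + 1) / 2 + 0"
      by (rule tendsto_lowerbound) (use hausdorff_dim_le[OF \<tau>(2) that] in \<open>auto simp: \<tau>_def\<close>)
    then show ?thesis by (simp add: bad_def)
  qed
  have "negligible bad"
  proof (subst locally_negligible_alt, intro ballI)
    fix x0 assume x0: "x0 \<in> bad"
    have "x0 \<notin> \<Gamma>"
    proof
      assume "x0 \<in> \<Gamma>"
      then have "visible_part \<Gamma> x0 = {x0}" by (rule visible_part_of_member)
      moreover have "0 < \<tau> m" for m using \<tau>(1)[of m] \<sigma>(1)[of m] by argo
      ultimately show False using good[of x0] hausdorff_measure_singleton x0 by auto
    qed
    then obtain R where R: "0 < R" "ball x0 R \<inter> \<Gamma> = {}"
      using compact_imp_closed[OF comp] open_contains_ball[of "- \<Gamma>"] by blast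
    have "AE x in lborel. \<forall>m. x \<in> ball x0 (R / 8) \<longrightarrow> hausdorff_measure (\<tau> m) (visible_part \<Gamma> x) = 0"
      unfolding AE_all_countable
      using AE_local_null_visible_part[OF comp conn R \<sigma>(1) \<sigma>(3) \<tau>(1)] by blast
    then have "AE x in lebesgue. \<forall>m. x \<in> ball x0 (R / 8) \<longrightarrow> hausdorff_measure (\<tau> m) (visible_part \<Gamma> x) = 0"
      by (rule AE_completion)
    then have "AE x in lebesgue. \<not> x \<in> bad \<inter> ball x0 (R / 8)"
      by (rule AE_mp, intro AE_I2) (use good in blast)
    moreover have "{x \<in> space lebesgue. \<not> x \<notin> bad \<inter> ball x0 (R / 8)} = bad \<inter> ball x0 (R / 8)" by auto
    ultimately have "negligible (bad \<inter> ball x0 (R / 8))"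
      unfolding completion.AE_iff_null_sets negligible_iff_null_sets by simp
    moreover have "openin (top_of_set bad) (bad \<inter> ball x0 (R / 8))" by (simp add: openin_open_Int)
    moreover have "x0 \<in> bad \<inter> ball x0 (R / 8)" using x0 R by simp
    ultimately show "\<exists>U. openin (top_of_set bad) U \<and> x0 \<in> U \<and> negligible U" by blast
  qed
  then show ?thesis
    unfolding completion.AE_iff_null_sets negligible_iff_null_sets bad_def s_def by simp
qed

theorem theorem1p1:
  fixes \<Gamma> :: "(real ^ 2) set"
  assumes "compact \<Gamma>" and "connected \<Gamma>" and "hausdorff_dim \<Gamma> > 1"
  shows "AE x in lebesgue.
           hausdorff_dim (visible_part \<Gamma> x) \<le> 1 / 2 + sqrt (hausdorff_dim \<Gamma> - 3 / 4)"
proof -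
  have "hausdorff_dim \<Gamma> \<le> 3"
    using hausdorff_measure_3_bounded[OF compact_imp_bounded[OF assms(1)]] by (intro hausdorff_dim_le) auto
  then have "(hausdorff_dim \<Gamma> + 1) / 2 \<le> 1 / 2 + sqrt (hausdorff_dim \<Gamma> - 3 / 4)"
    using assms(3) by (intro half_dim_le_bound) auto
  then show ?thesis
    by (intro eventually_mono[OF AE_dim_visible_part_le_half[OF assms]]) (rule order_trans)
qed

end
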